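(* Let $\mathcal C_X$ be the two-qubit CNOT channel, with Alice holding the target qubit and Bob the control qubit. Then $$\Sigma_\infty(\mathcal C_X)=\lim_{n\to\infty}\Sigma(\mathcal C_X^{\otimes n})=2\qquad\text{and}\qquad C_\infty(\mathcal C_X)=\lim_{n\to\infty}C(\mathcal C_X^{\otimes n})=2 .$$
   Context: All systems are finite-dimensional quantum systems; system $X$ has complex Hilbert space $\mathcal H_X$ of dimension $d_X$, and the composite system $XY$ has Hilbert space $\mathcal H_X\otimes\mathcal H_Y$. $\mathsf{St}(X)$ is the set of density operators on $\mathcal H_X$. $\mathfrak C(X,Y)$ is the set of quantum channels (completely positive trace-preserving linear maps) from operators on $\mathcal H_X$ to operators on $\mathcal H_Y$, and $\mathfrak C(X)=\mathfrak C(X,X)$. $\mathcal I_X$ is the identity channel on $X$. $\|X\|_1=\mathrm{Tr}\sqrt{X^\dagger X}$. For a Hermitian-preserving linear map $\mathcal L$ with input system $X$, the diamond norm is $\|\mathcal L\|_\diamond=\sup_{\rho\in\mathsf{St}(EX)}\|(\mathcal I_E\otimes\mathcal L)(\rho)\|_1$ with $E\cong X$. For a bipartite unitary channel $\mathcal U:\rho\mapsto U\rho U^\dagger$ with $U:\mathcal H_A\otimes\mathcal H_B\to\mathcal H_{A'}\otimes\mathcal H_{B'}$ unitary, let $\mathcal T(\mathcal U)=(\mathcal I_A\otimes\mathcal U)\circ(\mathcal S_{AA}\otimes\mathcal I_B)\circ(\mathcal I_A\otimes\mathcal U^{-1})\in\mathfrak C(AA'B')$, where $\mathcal S_{AA}$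 is the swap of two copies of $A$. The signalling and the causal influence of $\mathcal U$ (from $A$ to $B'$) are $$\Sigma(\mathcal U)=\inf_{\mathcal C\in\mathfrak C(B,B')}\|(\mathrm{Tr}_{A'}\otimes\mathcal I_{B'})\circ\mathcal U-\mathrm{Tr}_A\otimes\mathcal C\|_\diamond,\qquad C(\mathcal U)=\inf_{\mathcal C\in\mathfrak C(AA')}\|\mathcal T(\mathcal U)-\mathcal C\otimes\mathcal I_{B'}\|_\diamond .$$ The CNOT gate is the unitary on $\mathbb C^2\otimes\mathbb C^2$ with $\mathrm{CNOT}(|a\rangle\otimes|b\rangle)=|a\oplus b\rangle\otimes|b\rangle$ for $a,b\in\{0,1\}$ ($\oplus$ is addition modulo 2), and $\mathcal C_X:\rho\mapsto\mathrm{CNOT}\,\rho\,\mathrm{CNOT}$. Alice's input $A$ and output $A'$ are the first (target) qubit and Bob's input $B$ and output $B'$ are the second (control) qubit. $\mathcal C_X^{\otimes n}$ is regarded as a bipartite unitary channel with Alice's input $A^{\otimes n}$ and output $A'^{\otimes n}$, and Bob's input $B^{\otimes n}$ and output $B'^{\otimes n}$. *)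

theory Defs
  imports Complex_Main "Jordan_Normal_Form.Schur_Decomposition"
begin

section \<open>Operators\<close>

text \<open>
  A system of dimension \<open>d\<close> is represented by its dimension, and operators on it by complex
  \<open>d\<close> by \<open>d\<close> matrices in the computational basis. The composite of systems of dimensions
  \<open>d\<close> and \<open>e\<close> has dimension \<open>d * e\<close>; the product basis vector with labels \<open>i < d\<close>, \<open>j < e\<close>
  has index \<open>i * e + j\<close>. With this convention tensor products are strictly associative, and a
  trivial (one-dimensional) factor can be dropped.
\<close>

definition mat_trace :: "complex mat \<Rightarrow> complex" where
  "mat_trace A = (\<Sum>i<dim_row A. A $$ (i, i))"

text \<open>The order on \<open>complex\<close> makes \<open>0 \<le> z\<close> mean that \<open>z\<close> is real and nonnegative.\<close>

definition psd :: "complex mat \<Rightarrow> bool" where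
  "psd A \<longleftrightarrow> square_mat A \<and> (\<forall>v \<in> carrier_vec (dim_row A). 0 \<le> (A *\<^sub>v v) \<bullet>c v)"

definition density_operators :: "nat \<Rightarrow> complex mat set" where
  "density_operators d = {\<rho> \<in> carrier_mat d d. psd \<rho> \<and> mat_trace \<rho> = 1}"

definition psd_sqrt :: "complex mat \<Rightarrow> complex mat" where
  "psd_sqrt P = (THE R. R \<in> carrier_mat (dim_row P) (dim_row P) \<and> psd R \<and> R * R = P)"

definition trace_norm :: "complex mat \<Rightarrow> real" where
  "trace_norm X = Re (mat_trace (psd_sqrt (mat_adjoint X * X)))"

definition kron :: "complex mat \<Rightarrow> complex mat \<Rightarrow> complex mat" where
  "kron A B = mat (dim_row A * dim_row B) (dim_col A * dim_col B)
     (\<lambda>(r, s). A $$ (r div dim_row B, s div dim_col B) * B $$ (r mod dim_row B, s mod dim_col B))"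

definition mat_unit :: "nat \<Rightarrow> nat \<Rightarrow> nat \<Rightarrow> complex mat" where
  "mat_unit d i j = mat d d (\<lambda>(k, l). if k = i \<and> l = j then 1 else 0)"

text \<open>The unitary \<open>X \<otimes> Y \<rightarrow> Y \<otimes> X\<close>, \<open>|x\<rangle> \<otimes> |y\<rangle> \<mapsto> |y\<rangle> \<otimes> |x\<rangle>\<close>.\<close>

definition swap_mat :: "nat \<Rightarrow> nat \<Rightarrow> complex mat" where
  "swap_mat dX dY = mat (dY * dX) (dX * dY)
     (\<lambda>(r, s). if r = (s mod dY) * dX + s div dY then 1 else 0)"


section \<open>Linear maps between operator spaces\<close>

text \<open>
  A map from operators on a system \<open>X\<close> to operators on a system \<open>Y\<close> is a HOL function whose values
  matter only on \<open>carrier_mat dX dX\<close>.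
\<close>

type_synonym superop = "complex mat \<Rightarrow> complex mat"

definition linear_superop :: "nat \<Rightarrow> nat \<Rightarrow> superop \<Rightarrow> bool" where
  "linear_superop dX dY L \<longleftrightarrow>
     (\<forall>A \<in> carrier_mat dX dX. L A \<in> carrier_mat dY dY) \<and>
     (\<forall>A \<in> carrier_mat dX dX. \<forall>B \<in> carrier_mat dX dX. L (A + B) = L A + L B) \<and>
     (\<forall>A \<in> carrier_mat dX dX. \<forall>c. L (c \<cdot>\<^sub>m A) = c \<cdot>\<^sub>m L A)"

text \<open>
  For linear \<open>L\<close> from \<open>X\<close> to \<open>Y\<close> and \<open>M\<close> from \<open>Z\<close> to \<open>W\<close>, the map \<open>L \<otimes> M\<close>: the linear extension
  of \<open>kron A B \<mapsto> kron (L A) (M B)\<close>, obtained by expanding the argument in the matrix units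
  \<open>|i\<rangle>\<langle>j| \<otimes> |k\<rangle>\<langle>l|\<close>.
\<close>

definition tensor_map :: "nat \<Rightarrow> nat \<Rightarrow> superop \<Rightarrow> nat \<Rightarrow> nat \<Rightarrow> superop \<Rightarrow> superop" where
  "tensor_map dX dY L dZ dW M \<rho> = mat (dY * dW) (dY * dW)
     (\<lambda>(r, s). \<Sum>i<dX. \<Sum>j<dX. \<Sum>k<dZ. \<Sum>l<dZ.
        \<rho> $$ (i * dZ + k, j * dZ + l) * kron (L (mat_unit dX i j)) (M (mat_unit dZ k l)) $$ (r, s))"

definition id_map :: superop where
  "id_map \<rho> = \<rho>"

text \<open>The trace, with values in the operators on the one-dimensional system.\<close>

definition trace_map :: superop where
  "trace_map \<rho> = mat 1 1 (\<lambda>_. mat_trace \<rho>)"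

definition conj_map :: "complex mat \<Rightarrow> superop" where
  "conj_map V \<rho> = V * \<rho> * mat_adjoint V"

definition swap_map :: "nat \<Rightarrow> nat \<Rightarrow> superop" where
  "swap_map dX dY = conj_map (swap_mat dX dY)"

definition channels :: "nat \<Rightarrow> nat \<Rightarrow> superop set" where
  "channels dX dY = {L. linear_superop dX dY L \<and>
     (\<forall>k. \<forall>\<rho> \<in> carrier_mat (k * dX) (k * dX). psd \<rho> \<longrightarrow> psd (tensor_map k k id_map dX dY L \<rho>)) \<and>
     (\<forall>\<rho> \<in> carrier_mat dX dX. mat_trace (L \<rho>) = mat_trace \<rho>)}"

definition diamond_norm :: "nat \<Rightarrow> nat \<Rightarrow> superop \<Rightarrow> real" where
  "diamond_norm dX dY L =
     (SUP \<rho> \<in> density_operators (dX * dX). trace_norm (tensor_map dX dX id_map dX dY L \<rho>))"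


section \<open>Bipartite unitary channels\<close>

text \<open>
  Throughout, \<open>\<U>\<close> is a unitary channel from \<open>A \<otimes> B\<close> to \<open>A' \<otimes> B'\<close>, and \<open>dA dB dA' dB'\<close> are the
  dimensions of these four systems.
\<close>

definition signalling :: "nat \<Rightarrow> nat \<Rightarrow> nat \<Rightarrow> nat \<Rightarrow> superop \<Rightarrow> real" where
  "signalling dA dB dA' dB' \<U> =
     (INF \<C> \<in> channels dB dB'. diamond_norm (dA * dB) dB'
        (\<lambda>\<rho>. tensor_map dA' 1 trace_map dB' dB' id_map (\<U> \<rho>)
             - tensor_map dA 1 trace_map dB dB' \<C> \<rho>))"

definition inverse_superop :: "nat \<Rightarrow> superop \<Rightarrow> superop" where
  "inverse_superop d \<U> = inv_into (carrier_mat d d) \<U>"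

definition T_map :: "nat \<Rightarrow> nat \<Rightarrow> nat \<Rightarrow> nat \<Rightarrow> superop \<Rightarrow> superop" where
  "T_map dA dB dA' dB' \<U> =
     tensor_map dA dA id_map (dA * dB) (dA' * dB') \<U>
     \<circ> tensor_map (dA * dA) (dA * dA) (swap_map dA dA) dB dB id_map
     \<circ> tensor_map dA dA id_map (dA' * dB') (dA * dB) (inverse_superop (dA * dB) \<U>)"

definition causal_influence :: "nat \<Rightarrow> nat \<Rightarrow> nat \<Rightarrow> nat \<Rightarrow> superop \<Rightarrow> real" where
  "causal_influence dA dB dA' dB' \<U> =
     (INF \<C> \<in> channels (dA * dA') (dA * dA'). diamond_norm (dA * dA' * dB') (dA * dA' * dB')
        (\<lambda>\<rho>. T_map dA dB dA' dB' \<U> \<rho>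
             - tensor_map (dA * dA') (dA * dA') \<C> dB' dB' id_map \<rho>))"


section \<open>Tensor powers of bipartite channels\<close>

text \<open>
  The regrouping \<open>(X1 \<otimes> X2) \<otimes> (X3 \<otimes> X4) \<rightarrow> (X1 \<otimes> X3) \<otimes> (X2 \<otimes> X4)\<close>.
\<close>

definition regroup_map :: "nat \<Rightarrow> nat \<Rightarrow> nat \<Rightarrow> nat \<Rightarrow> superop" where
  "regroup_map d1 d2 d3 d4 =
     conj_map (kron (kron (1\<^sub>m d1) (swap_mat d2 d3)) (1\<^sub>m d4))"

text \<open>
  For \<open>\<U>\<close> from \<open>A1 \<otimes> B1\<close> to \<open>A1' \<otimes> B1'\<close> and \<open>\<V>\<close> from \<open>A2 \<otimes> B2\<close> to \<open>A2' \<otimes> B2'\<close>, the channel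
  \<open>\<U> \<otimes> \<V>\<close> regarded as a bipartite channel from \<open>(A1 \<otimes> A2) \<otimes> (B1 \<otimes> B2)\<close> to
  \<open>(A1' \<otimes> A2') \<otimes> (B1' \<otimes> B2')\<close>.
\<close>

definition bipartite_tensor ::
  "nat \<Rightarrow> nat \<Rightarrow> nat \<Rightarrow> nat \<Rightarrow> superop \<Rightarrow> nat \<Rightarrow> nat \<Rightarrow> nat \<Rightarrow> nat \<Rightarrow> superop \<Rightarrow> superop" where
  "bipartite_tensor dA1 dB1 dA1' dB1' \<U> dA2 dB2 dA2' dB2' \<V> =
     regroup_map dA1' dB1' dA2' dB2'
     \<circ> tensor_map (dA1 * dB1) (dA1' * dB1') \<U> (dA2 * dB2) (dA2' * dB2') \<V>
     \<circ> regroup_map dA1 dA2 dB1 dB2"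

fun tensor_power :: "nat \<Rightarrow> nat \<Rightarrow> nat \<Rightarrow> nat \<Rightarrow> superop \<Rightarrow> nat \<Rightarrow> superop" where
  "tensor_power dA dB dA' dB' \<U> 0 = id_map"
| "tensor_power dA dB dA' dB' \<U> (Suc n) =
     bipartite_tensor (dA ^ n) (dB ^ n) (dA' ^ n) (dB' ^ n) (tensor_power dA dB dA' dB' \<U> n)
       dA dB dA' dB' \<U>"

definition signalling_power :: "nat \<Rightarrow> nat \<Rightarrow> nat \<Rightarrow> nat \<Rightarrow> superop \<Rightarrow> nat \<Rightarrow> real" where
  "signalling_power dA dB dA' dB' \<U> n =
     signalling (dA ^ n) (dB ^ n) (dA' ^ n) (dB' ^ n) (tensor_power dA dB dA' dB' \<U> n)"

definition causal_influence_power :: "nat \<Rightarrow> nat \<Rightarrow> nat \<Rightarrow> nat \<Rightarrow> superop \<Rightarrow> nat \<Rightarrow> real" where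
  "causal_influence_power dA dB dA' dB' \<U> n =
     causal_influence (dA ^ n) (dB ^ n) (dA' ^ n) (dB' ^ n) (tensor_power dA dB dA' dB' \<U> n)"

definition signalling_infty :: "nat \<Rightarrow> nat \<Rightarrow> nat \<Rightarrow> nat \<Rightarrow> superop \<Rightarrow> real" where
  "signalling_infty dA dB dA' dB' \<U> = lim (signalling_power dA dB dA' dB' \<U>)"

definition causal_influence_infty :: "nat \<Rightarrow> nat \<Rightarrow> nat \<Rightarrow> nat \<Rightarrow> superop \<Rightarrow> real" where
  "causal_influence_infty dA dB dA' dB' \<U> = lim (causal_influence_power dA dB dA' dB' \<U>)"


section \<open>The CNOT channel\<close>

text \<open>
  The first factor (Alice) is the target, the second (Bob) the control:
  \<open>|a\<rangle> \<otimes> |b\<rangle> \<mapsto> |a \<oplus> b\<rangle> \<otimes> |b\<rangle>\<close>, where \<open>|a\<rangle> \<otimes> |b\<rangle>\<close> has index \<open>2 * a + b\<close>.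
\<close>

definition CNOT :: "complex mat" where
  "CNOT = mat 4 4 (\<lambda>(r, s).
     if r div 2 = (s div 2 + s mod 2) mod 2 \<and> r mod 2 = s mod 2 then 1 else 0)"

definition CNOT_channel :: superop where
  "CNOT_channel \<rho> = CNOT * \<rho> * CNOT"

end

(* With N = 2^n, the n-th power of CNOT sends |a>|b> to |a xor b>|b> for a, b < N. Both quantities
   are at most 2 because they compare density operators. For the lower bounds use phase kickback.

   Signalling: let Alice's input be maximally entangled with the reference and Bob's input be uniform.
   After the gate and the trace over A', the state on the reference and B' is 1/N times the projection
   onto the N vectors N^(-1/2) sum_b |b xor c>|b>, while any state of the form Tr_A (x) C gives that
   projection the weight 1/N. Hence the trace distance is at least 2 (1 - 1/N).

   Causal influence: T sends |x, y, b> to |y xor b, x xor b, b>. If A holds the parity character and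
   A', B' hold uniform superpositions, then the parity character is kicked back onto B', whereas
   C (x) I leaves B' uniform. These are orthogonal, so the distance is exactly 2 as soon as n > 0. *)

theory Submission
  imports Defs "Jordan_Normal_Form.Spectral_Radius"
begin

section \<open>The trace norm of a Hermitian matrix\<close>

text \<open>All lower bounds rest on one mechanism: for states \<open>P\<close>, \<open>Q\<close>
  and an operator \<open>E\<close> between 0 and 1, twice the trace of \<open>E (P - Q)\<close> is
  at most the trace norm of \<open>P - Q\<close>. State and test are fixed in advance and must work
  against every competing channel at once. The tests are sums of rank-one terms, so they enter as
  finite families of vectors obeying Bessel's inequality. The obstacle is that
  \<open>trace_norm\<close> goes through a square root given by a definite description: evaluating
  it at all requires an eigenbasis and the uniqueness of positive square roots, so both are proved
  for matrices of any size. Apart from the unknown channel, every map involved only permutes or sums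
  over computational basis labels. Treating such maps as pullbacks of matrix entries along index
  functions turns tensor powers and \<open>T_map\<close> into arithmetic with div and mod. The
  character \<open>(-1) ^ b\<close> depends only on the lowest bit of \<open>b\<close>: for the
  causal influence a single one of the n gates does the work, whereas the signalling test uses all N
  labels.\<close>

lemma mat_adjoint_eq: "mat_adjoint A = mat (dim_col A) (dim_row A) (\<lambda>(i, j). cnj (A $$ (j, i)))"
  unfolding mat_adjoint_def by (rule eq_matI) (auto simp: mat_of_rows_def)

lemma mat_adjoint_carrier [simp]: "(A :: complex mat) \<in> carrier_mat n m \<Longrightarrow> mat_adjoint A \<in> carrier_mat m n"
  by (auto simp: mat_adjoint_eq)

lemma dim_mat_adjoint [simp]:
  "dim_row (mat_adjoint A) = dim_col A" "dim_col (mat_adjoint A) = dim_row A"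
  for A :: "complex mat"
  by (auto simp: mat_adjoint_eq)

lemma mat_adjoint_index [simp]:
  "i < dim_col A \<Longrightarrow> j < dim_row A \<Longrightarrow> mat_adjoint A $$ (i, j) = cnj (A $$ (j, i))"
  for A :: "complex mat"
  by (simp add: mat_adjoint_eq)

lemma mult_mat_index:
  "A \<in> carrier_mat n m \<Longrightarrow> B \<in> carrier_mat m k \<Longrightarrow> i < n \<Longrightarrow> j < k \<Longrightarrow>
   (A * B) $$ (i, j) = (\<Sum>l<m. A $$ (i, l) * B $$ (l, j))"
  by (auto simp: scalar_prod_def lessThan_atLeast0)

lemma mat_adjoint_mult:
  assumes "A \<in> carrier_mat n m" "B \<in> carrier_mat m k"
  shows "mat_adjoint (A * B) = mat_adjoint B * mat_adjoint (A :: complex mat)"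
proof (rule eq_matI)
  fix i j assume "i < dim_row (mat_adjoint B * mat_adjoint A)" "j < dim_col (mat_adjoint B * mat_adjoint A)"
  then have ij: "i < k" "j < n" using assms by (auto simp: mat_adjoint_eq)
  have "(mat_adjoint B * mat_adjoint A) $$ (i, j) = (\<Sum>l<m. cnj (B $$ (l, i)) * cnj (A $$ (j, l)))"
    using assms ij by (subst mult_mat_index[of _ k m _ n]) auto
  then show "mat_adjoint (A * B) $$ (i, j) = (mat_adjoint B * mat_adjoint A) $$ (i, j)"
    using assms ij by (subst mat_adjoint_index) (auto simp del: index_mult_mat(1) simp: mult_mat_index mult.commute)
qed (use assms in \<open>auto simp: mat_adjoint_eq\<close>)

text \<open>The matrix is the Householder reflection exchanging the first basis vector with
  \<open>v\<close>. The exchange works because \<open>v 0\<close> is real, and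
  \<open>x \<le> 0\<close> keeps \<open>v\<close> away from the first basis vector, so that the
  denominator \<open>1 - x\<close> is at least 1.\<close>

lemma householder_unitary:
  fixes v :: "nat \<Rightarrow> complex"
  assumes unit: "(\<Sum>r<n. v r * cnj (v r)) = 1" and n: "0 < n" and v0: "v 0 = of_real x" "x \<le> 0"
  shows "\<exists>W \<in> carrier_mat n n. mat_adjoint W = W \<and> W * W = 1\<^sub>m n \<and> (\<forall>r<n. W $$ (r, 0) = v r)"
proof -
  define w where "w r = v r - (if r = 0 then 1 else 0)" for r
  define c :: complex where "c = of_real (1 - x)"
  have c: "c \<noteq> 0" "cnj c = c" using v0 unfolding c_def by (auto simp del: of_real_diff)
  define W where "W = mat n n (\<lambda>(r, s). (if r = s then 1 else 0) - w r * cnj (w s) / c)"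
  have W: "W \<in> carrier_mat n n" unfolding W_def by simp
  \<comment> \<open>For \<open>w = v - e_0\<close> the squared length is \<open>2 - 2 x\<close>, so
    dividing by \<open>c\<close> is the usual factor \<open>2 / |w|^2\<close> of a
    reflection.\<close>
  have ww: "(\<Sum>k<n. w k * cnj (w k)) = 2 * c"
  proof -
    have "(\<Sum>k<n. w k * cnj (w k)) = (\<Sum>k<n. v k * cnj (v k) - (if k = 0 then v 0 + cnj (v 0) - 1 else 0))"
      by (rule sum.cong) (auto simp: w_def algebra_simps)
    also have "\<dots> = 2 * c"
      using n v0 by (simp add: sum_subtractf unit c_def)
    finally show ?thesis .
  qed
  have adj: "mat_adjoint W = W"
    by (rule eq_matI) (auto simp: W_def mat_adjoint_eq c)
  have "W * W = 1\<^sub>m n"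
  proof (rule eq_matI)
    fix r s assume "r < dim_row (1\<^sub>m n)" "s < dim_col (1\<^sub>m n)"
    then have rs: "r < n" "s < n" by auto
    have "(W * W) $$ (r, s) = (\<Sum>k<n. ((if r = k then 1 else 0) - w r * cnj (w k) / c) * ((if k = s then 1 else 0) - w k * cnj (w s) / c))"
      using rs by (subst mult_mat_index[OF W W]) (auto simp: W_def)
    also have "\<dots> = (\<Sum>k<n. (if k = r then (if r = s then 1 else 0) - w r * cnj (w s) / c else 0)
        - (if k = s then w r * cnj (w s) / c else 0) + (w r * cnj (w s) / c^2) * (w k * cnj (w k)))"
      by (rule sum.cong) (auto simp: algebra_simps power2_eq_square)
    also have "\<dots> = ((if r = s then 1 else 0) - w r * cnj (w s) / c) - w r * cnj (w s) / c + (w r * cnj (w s) / c^2) * (2 * c)"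
      using rs by (simp add: sum.distrib sum_subtractf ww sum_distrib_left[symmetric] del: times_divide_eq_left)
    also have "\<dots> = (if r = s then 1 else 0)"
      using c by (simp add: field_simps power2_eq_square)
    finally show "(W * W) $$ (r, s) = 1\<^sub>m n $$ (r, s)" using rs by simp
  qed (use W in auto)
  moreover have "W $$ (r, 0) = v r" if "r < n" for r
  proof -
    have "w 0 = - c" "v 0 = 1 - c" using v0 by (simp_all add: w_def c_def)
    then show ?thesis using that n c by (auto simp: W_def) (auto simp: w_def)
  qed
  ultimately show ?thesis using W adj by blast
qed

section \<open>Spectral theorem for Hermitian matrices\<close>

definition real_diag :: "nat \<Rightarrow> (nat \<Rightarrow> real) \<Rightarrow> complex mat" where
  "real_diag n d = mat n n (\<lambda>(i, j). if i = j then of_real (d i) else 0)"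

lemma real_diag_carrier [simp]: "real_diag n d \<in> carrier_mat n n"
  by (simp add: real_diag_def)

lemma mult_real_diag_index:
  assumes "A \<in> carrier_mat m n" "i < m" "j < n"
  shows "(A * real_diag n d) $$ (i, j) = A $$ (i, j) * of_real (d j)"
  using assms
  by (subst mult_mat_index[OF assms(1) real_diag_carrier assms(2,3)])
     (simp add: real_diag_def if_distrib[of "\<lambda>x. _ * x"] cong: if_cong)

lemma real_diag_mult_index:
  assumes "A \<in> carrier_mat n m" "i < n" "j < m"
  shows "(real_diag n d * A) $$ (i, j) = of_real (d i) * A $$ (i, j)"
  using assms
  by (subst mult_mat_index[OF real_diag_carrier assms(1) assms(2,3)])
     (simp add: real_diag_def if_distrib[of "\<lambda>x. x * _"] cong: if_cong)

text \<open>Besides the length, the phase of an eigenvector is fixed, so that its first entry meets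
  the sign condition of the Householder reflection.\<close>

lemma exists_eigenvector_normalized:
  fixes A :: "complex mat"
  assumes A: "A \<in> carrier_mat n n" and n: "0 < n"
  shows "\<exists>v e x. (\<Sum>r<n. v r * cnj (v r)) = 1 \<and> v 0 = of_real x \<and> x \<le> 0
    \<and> (\<forall>r<n. (\<Sum>s<n. A $$ (r, s) * v s) = e * v r)"
proof -
  obtain e where "eigenvalue A e"
    using spectrum_non_empty[OF A n] by (auto simp: spectrum_def)
  then obtain u where u: "u \<in> carrier_vec n" "u \<noteq> 0\<^sub>v n" "A *\<^sub>v u = e \<cdot>\<^sub>v u"
    using A by (auto simp: eigenvalue_def eigenvector_def)
  have ev: "(\<Sum>s<n. A $$ (r, s) * u $ s) = e * u $ r" if "r < n" for r
  proof -
    have "(A *\<^sub>v u) $ r = (\<Sum>s<n. A $$ (r, s) * u $ s)"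
      using u(1) A that by (auto simp: scalar_prod_def lessThan_atLeast0)
    then show ?thesis using u that by simp
  qed
  define S where "S = (\<Sum>r<n. (cmod (u $ r))\<^sup>2)"
  have S0: "S > 0"
  proof -
    obtain r where "r < n" "u $ r \<noteq> 0" using u(1,2) by (metis carrier_vecD eq_vecI index_zero_vec)
    then show ?thesis unfolding S_def by (intro sum_pos2[of _ r]) auto
  qed
  \<comment> \<open>Rotates \<open>u $ 0\<close> onto the negative real axis; if that entry
    vanishes, every phase works and 1 is taken.\<close>
  define ph where "ph = (if u $ 0 = 0 then 1 else - cnj (u $ 0) / of_real (cmod (u $ 0)))"
  define v where "v r = ph * u $ r / of_real (sqrt S)" for r
  have ph: "cmod ph = 1" by (simp add: ph_def norm_divide)
  have "(\<Sum>r<n. v r * cnj (v r)) = of_real (\<Sum>r<n. (cmod (v r))\<^sup>2)"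
    by (simp add: complex_norm_square[symmetric])
  also have "(\<Sum>r<n. (cmod (v r))\<^sup>2) = (\<Sum>r<n. (cmod (u $ r))\<^sup>2 / S)"
    using S0 by (intro sum.cong) (auto simp: v_def norm_mult norm_divide ph power_divide)
  also have "\<dots> = 1" using S0 by (simp add: sum_divide_distrib[symmetric] S_def)
  finally have "(\<Sum>r<n. v r * cnj (v r)) = 1" by simp
  moreover have "v 0 = of_real (- cmod (u $ 0) / sqrt S)"
  proof -
    have "ph * u $ 0 = - of_real (cmod (u $ 0))"
      using complex_norm_square[of "u $ 0"]
      by (auto simp: ph_def power2_eq_square field_simps)
    then show ?thesis by (simp add: v_def)
  qed
  moreover have "- cmod (u $ 0) / sqrt S \<le> 0" using S0 by simp
  moreover have "(\<Sum>s<n. A $$ (r, s) * v s) = e * v r" if "r < n" for r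
  proof -
    have "(\<Sum>s<n. A $$ (r, s) * v s) = (\<Sum>s<n. (A $$ (r, s) * u $ s)) * (ph / of_real (sqrt S))"
      unfolding sum_distrib_right by (rule sum.cong) (simp_all add: v_def)
    then show ?thesis using ev[OF that] by (simp add: v_def)
  qed
  ultimately show ?thesis by blast
qed

text \<open>Deflation: conjugating by a reflection whose first column is an eigenvector clears the
  rest of the first column, hermiticity clears the first row, and the induction hypothesis
  diagonalises the remaining block.\<close>

lemma hermitian_spectral_decomposition:
  assumes "A \<in> carrier_mat n n" "mat_adjoint A = A"
  shows "\<exists>U \<in> carrier_mat n n. \<exists>d. mat_adjoint U * U = 1\<^sub>m n \<and> U * mat_adjoint U = 1\<^sub>m n
    \<and> A = U * real_diag n d * mat_adjoint U"
  using assms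
proof (induction n arbitrary: A)
  case 0
  then show ?case by (intro bexI[of _ "1\<^sub>m 0"] exI[of _ "\<lambda>_. 0"]) (auto simp: mat_adjoint_eq intro!: eq_matI)
next
  case (Suc n)
  note A = Suc.prems
  obtain v e x where v: "(\<Sum>r<Suc n. v r * cnj (v r)) = 1" "v 0 = complex_of_real x" "x \<le> 0"
    and ev: "\<And>r. r < Suc n \<Longrightarrow> (\<Sum>s<Suc n. A $$ (r, s) * v s) = e * v r"
    using exists_eigenvector_normalized[OF A(1)] by blast
  obtain W where W: "W \<in> carrier_mat (Suc n) (Suc n)" "mat_adjoint W = W" "W * W = 1\<^sub>m (Suc n)"
    and W0: "\<And>r. r < Suc n \<Longrightarrow> W $$ (r, 0) = v r"
    using householder_unitary[OF v(1) _ v(2,3)] by auto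
  define A' where "A' = W * A * W"
  have A': "A' \<in> carrier_mat (Suc n) (Suc n)" unfolding A'_def using W A by auto
  have A'h: "mat_adjoint A' = A'"
    unfolding A'_def using W A
    by (simp add: mat_adjoint_mult[of _ "Suc n" "Suc n" _ "Suc n"] assoc_mult_mat[of _ "Suc n" "Suc n" _ "Suc n" _ "Suc n"])
  have AA': "A = W * A' * W"
  proof -
    have "W * A' * W = (W * W) * A * (W * W)"
      unfolding A'_def using W(1) A(1) by (simp add: assoc_mult_mat[of _ "Suc n" "Suc n" _ "Suc n" _ "Suc n"])
    then show ?thesis using W A by simp
  qed
  \<comment> \<open>The first column of \<open>W\<close> is an eigenvector, so
    \<open>A W e_0 = e W e_0\<close>, and \<open>W W = 1\<close> turns this into \<open>e\<close>
    times the first basis vector.\<close>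
  have col0: "A' $$ (r, 0) = (if r = 0 then e else 0)" if r: "r < Suc n" for r
  proof -
    have AW: "(A * W) $$ (s, 0) = e * W $$ (s, 0)" if s: "s < Suc n" for s
    proof -
      have "(A * W) $$ (s, 0) = (\<Sum>l<Suc n. A $$ (s, l) * W $$ (l, 0))"
        by (rule mult_mat_index[OF A(1) W(1) s]) simp
      also have "\<dots> = (\<Sum>l<Suc n. A $$ (s, l) * v l)" by (rule sum.cong) (auto simp: W0)
      finally show ?thesis using ev[OF s] W0[OF s] by simp
    qed
    have "A' $$ (r, 0) = (\<Sum>l<Suc n. W $$ (r, l) * (A * W) $$ (l, 0))"
      unfolding A'_def assoc_mult_mat[OF W(1) A(1) W(1)]
      by (rule mult_mat_index[OF W(1) mult_carrier_mat[OF A(1) W(1)] r]) simp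
    also have "\<dots> = (\<Sum>l<Suc n. W $$ (r, l) * (e * W $$ (l, 0)))"
      by (rule sum.cong[OF refl]) (simp only: AW lessThan_iff)
    also have "\<dots> = e * (W * W) $$ (r, 0)"
      using r by (subst mult_mat_index[OF W(1) W(1)]) (auto simp: sum_distrib_left algebra_simps)
    finally show ?thesis using r W(3) by simp
  qed
  have sym: "A' $$ (r, s) = cnj (A' $$ (s, r))" if "r < Suc n" "s < Suc n" for r s
    using that A' by (subst A'h[symmetric], subst mat_adjoint_index) auto
  \<comment> \<open>The corner entry of a Hermitian matrix is real, which allows a real
    diagonal.\<close>
  have e: "e = of_real (Re e)"
    using sym[of 0 0] col0[of 0] by (simp add: complex_eq_iff)
  define B where "B = mat n n (\<lambda>(i, j). A' $$ (Suc i, Suc j))"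
  have B: "B \<in> carrier_mat n n" "mat_adjoint B = B"
    unfolding B_def by (auto simp: mat_adjoint_eq intro!: eq_matI sym[symmetric])
  obtain V d where V: "V \<in> carrier_mat n n" "mat_adjoint V * V = 1\<^sub>m n" "V * mat_adjoint V = 1\<^sub>m n"
    and BV: "B = V * real_diag n d * mat_adjoint V"
    using Suc.IH[OF B] by blast
  define U where "U = four_block_mat (1\<^sub>m 1) (0\<^sub>m 1 n) (0\<^sub>m n 1) V"
  have Uc: "U \<in> carrier_mat (Suc n) (Suc n)" unfolding U_def using V four_block_carrier_mat[of "1\<^sub>m 1" 1 1 V n n] by auto
  have Uadj: "mat_adjoint U = four_block_mat (1\<^sub>m 1) (0\<^sub>m 1 n) (0\<^sub>m n 1) (mat_adjoint V)"
    using V by (auto simp: U_def mat_adjoint_eq four_block_mat_def Let_def intro!: eq_matI)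
  have one: "four_block_mat (1\<^sub>m 1) (0\<^sub>m 1 n) (0\<^sub>m n 1) (1\<^sub>m n) = (1\<^sub>m (Suc n) :: complex mat)"
    by (auto simp: four_block_mat_def Let_def intro!: eq_matI)
  have UU: "mat_adjoint U * U = 1\<^sub>m (Suc n)" "U * mat_adjoint U = 1\<^sub>m (Suc n)"
    unfolding Uadj unfolding U_def
    using V mat_adjoint_carrier[OF V(1)] one
    by (simp_all add: mult_four_block_mat[of _ 1 1 _ n _ n _ _ 1 _ n] right_mult_zero_mat[of _ n n] left_mult_zero_mat[of _ n n])
  define d' where "d' i = (case i of 0 \<Rightarrow> Re e | Suc i \<Rightarrow> d i)" for i
  have diag: "real_diag (Suc n) d' = four_block_mat (mat 1 1 (\<lambda>_. e)) (0\<^sub>m 1 n) (0\<^sub>m n 1) (real_diag n d)"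
    using e by (auto simp: real_diag_def four_block_mat_def Let_def d'_def intro!: eq_matI split: nat.splits)
  have A'4: "A' = four_block_mat (mat 1 1 (\<lambda>_. e)) (0\<^sub>m 1 n) (0\<^sub>m n 1) B"
  proof (rule eq_matI)
    fix i j assume "i < dim_row (four_block_mat (mat 1 1 (\<lambda>_. e)) (0\<^sub>m 1 n) (0\<^sub>m n 1) B)"
      "j < dim_col (four_block_mat (mat 1 1 (\<lambda>_. e)) (0\<^sub>m 1 n) (0\<^sub>m n 1) B)"
    then have "i < Suc n" "j < Suc n" by (auto simp: B_def)
    then show "A' $$ (i, j) = four_block_mat (mat 1 1 (\<lambda>_. e)) (0\<^sub>m 1 n) (0\<^sub>m n 1) B $$ (i, j)"
      using sym[of i j] col0[of i] col0[of j] by (cases i; cases j) (auto simp: four_block_mat_def Let_def B_def)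
  qed (use A' in \<open>auto simp: B_def\<close>)
  have A'U: "A' = U * real_diag (Suc n) d' * mat_adjoint U"
    unfolding Uadj diag A'4 BV unfolding U_def
    using V mat_adjoint_carrier[OF V(1)]
    by (simp add: mult_four_block_mat[of _ 1 1 _ n _ n _ _ 1 _ n] mult_carrier_mat[of _ n n _ n]
        right_mult_zero_mat[of _ n n] left_mult_zero_mat[of _ n n])
  let ?N = "Suc n"
  note assoc = assoc_mult_mat[of _ ?N ?N _ ?N _ ?N]
  have Ua: "mat_adjoint U \<in> carrier_mat ?N ?N" using Uc by simp
  have adjWU: "mat_adjoint (W * U) = mat_adjoint U * W"
    using mat_adjoint_mult[OF W(1) Uc] W by simp
  have "mat_adjoint (W * U) * (W * U) = mat_adjoint U * (W * W) * U"
    unfolding adjWU using W(1) Uc Ua by (simp add: assoc mult_carrier_mat[of _ ?N ?N _ ?N])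
  then have 1: "mat_adjoint (W * U) * (W * U) = 1\<^sub>m ?N" using W UU by (simp add: right_mult_one_mat[OF Ua])
  have "(W * U) * mat_adjoint (W * U) = W * (U * mat_adjoint U) * W"
    unfolding adjWU using W(1) Uc Ua by (simp add: assoc mult_carrier_mat[of _ ?N ?N _ ?N])
  then have 2: "(W * U) * mat_adjoint (W * U) = 1\<^sub>m ?N" using W UU by (simp add: right_mult_one_mat[OF W(1)])
  have "A = (W * U) * real_diag ?N d' * mat_adjoint (W * U)"
    unfolding adjWU AA' A'U using W(1) Uc Ua by (simp add: assoc mult_carrier_mat[of _ ?N ?N _ ?N])
  with 1 2 show ?case using W(1) Uc by (intro bexI[of _ "W * U"]) auto
qed

section \<open>Quadratic forms, positivity and positive square roots\<close>

definition quad_form :: "nat \<Rightarrow> complex mat \<Rightarrow> (nat \<Rightarrow> complex) \<Rightarrow> complex" where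
  "quad_form n A v = (\<Sum>r<n. \<Sum>s<n. cnj (v r) * A $$ (r, s) * v s)"

text \<open>Passes from \<open>vec\<close> to functions on basis labels, the form in which all test
  vectors are later written.\<close>

lemma psd_iff:
  assumes A: "A \<in> carrier_mat n n"
  shows "psd A \<longleftrightarrow> (\<forall>v. 0 \<le> quad_form n A v)"
proof -
  have form: "(A *\<^sub>v v) \<bullet>c v = (\<Sum>r<n. \<Sum>s<n. cnj (v $ r) * A $$ (r, s) * v $ s)"
    if "v \<in> carrier_vec n" for v
    using that A
    by (auto simp: scalar_prod_def lessThan_atLeast0 sum_distrib_left sum_distrib_right algebra_simps intro!: sum.cong)
  show ?thesis
    unfolding quad_form_def
  proof
    assume psd: "psd A"
    show "\<forall>v. 0 \<le> (\<Sum>r<n. \<Sum>s<n. cnj (v r) * A $$ (r, s) * v s)"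
    proof
      fix v :: "nat \<Rightarrow> complex"
      have "0 \<le> (A *\<^sub>v vec n v) \<bullet>c vec n v" using psd A by (auto simp: psd_def)
      then show "0 \<le> (\<Sum>r<n. \<Sum>s<n. cnj (v r) * A $$ (r, s) * v s)"
        by (subst (asm) form) auto
    qed
  next
    assume "\<forall>v. 0 \<le> (\<Sum>r<n. \<Sum>s<n. cnj (v r) * A $$ (r, s) * v s)"
    then show "psd A" using A by (auto simp: psd_def form simp del: mult_mat_vec_def)
  qed
qed

text \<open>Hermiticity is hidden in the order on the complex numbers: nonnegative values of the
  form are real. Testing on \<open>e_i + c e_j\<close> with \<open>c = 1\<close> and
  \<open>c = \<i>\<close> recovers the two real conditions on an off-diagonal pair.\<close>

lemma psd_hermitian:
  assumes A: "A \<in> carrier_mat n n" and psd: "psd A"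
  shows "mat_adjoint A = A"
proof (rule eq_matI)
  have q: "0 \<le> (\<Sum>r<n. \<Sum>s<n. cnj (v r) * A $$ (r, s) * v s)" for v
    using psd psd_iff[OF A] unfolding quad_form_def by blast
  have two: "0 \<le> A $$ (i, i) + c * A $$ (i, j) + cnj c * A $$ (j, i) + cnj c * c * A $$ (j, j)"
    if ij: "i < n" "j < n" "i \<noteq> j" for i j c
  proof -
    define v where "v k = (if k = i then 1 else if k = j then c else 0)" for k
    have in1: "(\<Sum>s<n. cnj (v r) * A $$ (r, s) * v s) = cnj (v r) * (A $$ (r, i) + A $$ (r, j) * c)" for r
    proof -
      have "(\<Sum>s<n. cnj (v r) * A $$ (r, s) * v s)
        = (\<Sum>s<n. (if s = i then cnj (v r) * A $$ (r, i) else 0) + (if s = j then cnj (v r) * A $$ (r, j) * c else 0))"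
        using ij by (intro sum.cong) (auto simp: v_def)
      then show ?thesis using ij by (simp add: sum.distrib algebra_simps)
    qed
    have "(\<Sum>r<n. \<Sum>s<n. cnj (v r) * A $$ (r, s) * v s)
        = (\<Sum>r<n. (if r = i then A $$ (i, i) + A $$ (i, j) * c else 0) + (if r = j then cnj c * (A $$ (j, i) + A $$ (j, j) * c) else 0))"
      unfolding in1 using ij by (intro sum.cong) (auto simp: v_def)
    also have "\<dots> = A $$ (i, i) + c * A $$ (i, j) + cnj c * A $$ (j, i) + cnj c * c * A $$ (j, j)"
      using ij by (simp add: sum.distrib algebra_simps)
    finally show ?thesis using q[of v] by simp
  qed
  have diag: "0 \<le> A $$ (i, i)" if "i < n" for i
  proof -
    have "(\<Sum>r<n. \<Sum>s<n. cnj (if r = i then 1 else 0) * A $$ (r, s) * (if s = i then 1 else 0)) = A $$ (i, i)"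
      using that by (simp add: if_distrib[of cnj] if_distrib[of "\<lambda>x. x * _"] if_distrib[of "\<lambda>x. _ * x"] cong: if_cong)
    then show ?thesis using q[of "\<lambda>k. if k = i then 1 else 0"] by simp
  qed
  fix i j assume "i < dim_row A" "j < dim_col A"
  then have ij: "i < n" "j < n" using A by auto
  have "cnj (A $$ (j, i)) = A $$ (i, j)"
  proof (cases "i = j")
    case True
    then show ?thesis using diag[OF ij(1)] by (simp add: less_eq_complex_def complex_eq_iff)
  next
    case False
    then show ?thesis
      using two[OF ij False, of 1] two[OF ij False, of \<i>] diag[OF ij(1)] diag[OF ij(2)]
      by (simp add: less_eq_complex_def complex_eq_iff)
  qed
  then show "mat_adjoint A $$ (i, j) = A $$ (i, j)" using ij A by simp
qed (use A in auto)

lemma conj_mat_index: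
  assumes "A \<in> carrier_mat n n" "V \<in> carrier_mat n m" "i < m" "j < m"
  shows "(mat_adjoint V * A * V) $$ (i, j) = (\<Sum>r<n. \<Sum>s<n. cnj (V $$ (r, i)) * A $$ (r, s) * V $$ (s, j))"
proof -
  have "(mat_adjoint V * A * V) $$ (i, j) = (\<Sum>s<n. (mat_adjoint V * A) $$ (i, s) * V $$ (s, j))"
    using assms(3,4) by (intro mult_mat_index[OF mult_carrier_mat[OF mat_adjoint_carrier[OF assms(2)] assms(1)] assms(2)])
  also have "\<dots> = (\<Sum>s<n. (\<Sum>r<n. cnj (V $$ (r, i)) * A $$ (r, s)) * V $$ (s, j))"
  proof (rule sum.cong[OF refl])
    fix s assume "s \<in> {..<n}"
    then have "(mat_adjoint V * A) $$ (i, s) = (\<Sum>r<n. mat_adjoint V $$ (i, r) * A $$ (r, s))"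
      using assms mat_adjoint_carrier[OF assms(2)] by (intro mult_mat_index) auto
    then show "(mat_adjoint V * A) $$ (i, s) * V $$ (s, j) = (\<Sum>r<n. cnj (V $$ (r, i)) * A $$ (r, s)) * V $$ (s, j)"
      using assms by simp
  qed
  also have "\<dots> = (\<Sum>r<n. \<Sum>s<n. cnj (V $$ (r, i)) * A $$ (r, s) * V $$ (s, j))"
    by (subst sum.swap) (simp add: sum_distrib_right)
  finally show ?thesis .
qed

lemma conj_mat_diag_nonneg:
  assumes "A \<in> carrier_mat n n" "psd A" "V \<in> carrier_mat n m" "i < m"
  shows "0 \<le> (mat_adjoint V * A * V) $$ (i, i)"
  using assms psd_iff[OF assms(1)] by (simp add: conj_mat_index quad_form_def del: index_mult_mat)

text \<open>For an orthonormal eigenbasis of \<open>R - S\<close>, the diagonal of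
  \<open>R (R - S) + (R - S) S = R\<^sup>2 - S\<^sup>2 = 0\<close> shows that each eigenvalue vanishes.\<close>

lemma psd_sqrt_unique:
  assumes R: "R \<in> carrier_mat n n" "psd R" and S: "S \<in> carrier_mat n n" "psd S"
    and sq: "R * R = S * S"
  shows "R = S"
proof -
  define M where "M = R - S"
  have M: "M \<in> carrier_mat n n" unfolding M_def using R S by auto
  have h: "mat_adjoint R = R" "mat_adjoint S = S" using psd_hermitian R S by auto
  have "mat_adjoint M = M"
  proof (rule eq_matI)
    fix i j assume "i < dim_row M" "j < dim_col M"
    then have ij: "i < n" "j < n" using M by auto
    have "R $$ (i, j) = cnj (R $$ (j, i))" "S $$ (i, j) = cnj (S $$ (j, i))"
      using h mat_adjoint_index[of i R j] mat_adjoint_index[of i S j] ij R S by auto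
    then show "mat_adjoint M $$ (i, j) = M $$ (i, j)" using ij M R S by (auto simp: M_def)
  qed (use M in auto)
  from hermitian_spectral_decomposition[OF M this] obtain V d
    where V: "V \<in> carrier_mat n n" "mat_adjoint V * V = 1\<^sub>m n" "V * mat_adjoint V = 1\<^sub>m n"
      and MV: "M = V * real_diag n d * mat_adjoint V" by blast
  let ?V = "mat_adjoint V" and ?D = "real_diag n d"
  have cV: "?V \<in> carrier_mat n n" using V by simp
  note assoc = assoc_mult_mat[of _ n n _ n _ n]
  define R' where "R' = ?V * R * V"
  define S' where "S' = ?V * S * V"
  have c: "R' \<in> carrier_mat n n" "S' \<in> carrier_mat n n" unfolding R'_def S'_def using cV V R S by auto
  have MV': "M * V = V * ?D"
  proof -
    have "M * V = V * ?D * (?V * V)" unfolding MV using V(1) cV by (simp add: assoc mult_carrier_mat[of _ n n _ n])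
    then show ?thesis using V(1) real_diag_carrier[of n d] by (simp add: V(2))
  qed
  have VM: "?V * M = ?D * ?V"
  proof -
    have "?V * M = (?V * V) * ?D * ?V" unfolding MV using V(1) cV by (simp add: assoc mult_carrier_mat[of _ n n _ n])
    then show ?thesis using V(1) cV real_diag_carrier[of n d] by (simp add: V(2))
  qed
  have "R * M + M * S = 0\<^sub>m n n"
  proof -
    have "R * M = R * R - R * S" unfolding M_def using R S by (intro mult_minus_distrib_mat) auto
    moreover have "M * S = R * S - S * S" unfolding M_def using R S by (intro minus_mult_distrib_mat) auto
    ultimately show ?thesis using R S sq by (auto intro!: eq_matI simp del: index_mult_mat(1))
  qed
  then have "?V * (R * M + M * S) * V = 0\<^sub>m n n" using V(1) cV by simp
  moreover have "?V * (R * M + M * S) * V = R' * ?D + ?D * S'"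
  proof -
    have "?V * (R * M + M * S) * V = ?V * (R * M) * V + ?V * (M * S) * V"
      using V(1) cV R S M by (simp add: mult_add_distrib_mat[of _ n n _ n] add_mult_distrib_mat[of _ n n _ _ n]
          mult_carrier_mat[of _ n n _ n])
    also have "?V * (R * M) * V = ?V * R * (M * V)" using V(1) cV R(1) S(1) M by (simp add: assoc mult_carrier_mat[of _ n n _ n])
    also have "\<dots> = R' * ?D" unfolding MV' R'_def using V(1) cV R(1) S(1) M by (simp add: assoc mult_carrier_mat[of _ n n _ n])
    also have "?V * (M * S) * V = (?V * M) * S * V" using V(1) cV R(1) S(1) M by (simp add: assoc mult_carrier_mat[of _ n n _ n])
    also have "\<dots> = ?D * S'" unfolding VM S'_def using V(1) cV R(1) S(1) M by (simp add: assoc mult_carrier_mat[of _ n n _ n])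
    finally show ?thesis .
  qed
  ultimately have zero: "R' * ?D + ?D * S' = 0\<^sub>m n n" by simp
  have "?D = R' - S'"
  proof -
    have "?V * M * V = ?D * (?V * V)"
      unfolding VM using V(1) cV by (simp add: assoc mult_carrier_mat[of _ n n _ n])
    then have "?V * M * V = ?D" by (simp add: V(2) right_mult_one_mat[OF real_diag_carrier])
    moreover have "?V * M * V = R' - S'"
      unfolding M_def R'_def S'_def using V(1) cV R S
      by (simp add: mult_minus_distrib_mat[of _ n n _ n] minus_mult_distrib_mat[of _ n n _ _ n]
          mult_carrier_mat[of _ n n _ n])
    ultimately show ?thesis by simp
  qed
  \<comment> \<open>Let \<open>r\<close> and \<open>s\<close> be the diagonal entries of
    \<open>R'\<close> and \<open>S'\<close>. Then \<open>d i = r - s\<close> and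
    \<open>d i * (r + s) = 0\<close> force \<open>r^2 = s^2\<close>, hence \<open>r = s\<close>,
    both being nonnegative.\<close>
  have "d i = 0" if i: "i < n" for i
  proof -
    have "(R' * ?D) $$ (i, i) = R' $$ (i, i) * of_real (d i)"
      using mult_real_diag_index[OF c(1) i i] .
    moreover have "(?D * S') $$ (i, i) = of_real (d i) * S' $$ (i, i)"
      using real_diag_mult_index[OF c(2) i i] .
    moreover have "(R' * ?D + ?D * S') $$ (i, i) = (R' * ?D) $$ (i, i) + (?D * S') $$ (i, i)"
      using i c by (intro index_add_mat) (auto simp: real_diag_def)
    ultimately have "of_real (d i) * (R' $$ (i, i) + S' $$ (i, i)) = 0"
      using i unfolding zero by (simp add: algebra_simps)
    moreover have "of_real (d i) = R' $$ (i, i) - S' $$ (i, i)"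
      using arg_cong[OF \<open>?D = R' - S'\<close>, of "\<lambda>A. A $$ (i, i)"] i c by (simp add: real_diag_def)
    moreover have "0 \<le> R' $$ (i, i)" "0 \<le> S' $$ (i, i)"
      unfolding R'_def S'_def using conj_mat_diag_nonneg R S V(1) i by auto
    ultimately show ?thesis
      by (auto simp: less_eq_complex_def complex_eq_iff)
  qed
  then have "?D = 0\<^sub>m n n" by (auto simp: real_diag_def intro!: eq_matI)
  then have "M = 0\<^sub>m n n" unfolding MV using V(1) cV by simp
  show ?thesis
  proof (rule eq_matI)
    fix i j assume "i < dim_row S" "j < dim_col S"
    then have ij: "i < n" "j < n" using S by auto
    have "M $$ (i, j) = 0" unfolding \<open>M = 0\<^sub>m n n\<close> using ij by simp
    then show "R $$ (i, j) = S $$ (i, j)" using ij R S by (simp add: M_def)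
  qed (use R S in auto)
qed

lemma spectral_index:
  assumes "U \<in> carrier_mat n n" "r < n" "s < n"
  shows "(U * real_diag n d * mat_adjoint U) $$ (r, s) = (\<Sum>i<n. of_real (d i) * U $$ (r, i) * cnj (U $$ (s, i)))"
proof -
  have 1: "(U * real_diag n d) $$ (r, i) = of_real (d i) * U $$ (r, i)" if "i < n" for i
    using mult_real_diag_index[OF assms(1,2) that] by simp
  have "(U * real_diag n d * mat_adjoint U) $$ (r, s) = (\<Sum>i<n. (U * real_diag n d) $$ (r, i) * mat_adjoint U $$ (i, s))"
    using assms mult_carrier_mat[OF assms(1) real_diag_carrier[of n d]] mat_adjoint_carrier[OF assms(1)]
    by (intro mult_mat_index) auto
  also have "\<dots> = (\<Sum>i<n. of_real (d i) * U $$ (r, i) * cnj (U $$ (s, i)))"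
    using assms by (intro sum.cong) (auto simp: 1 simp del: index_mult_mat(1))
  finally show ?thesis .
qed

lemma spectral_form:
  assumes U: "U \<in> carrier_mat n n" and A: "A = U * real_diag n d * mat_adjoint U"
  shows "quad_form n A v
    = of_real (\<Sum>i<n. d i * (cmod (\<Sum>r<n. cnj (v r) * U $$ (r, i)))\<^sup>2)"
proof -
  have "quad_form n A v
    = (\<Sum>r<n. \<Sum>s<n. \<Sum>i<n. of_real (d i) * ((cnj (v r) * U $$ (r, i)) * (cnj (U $$ (s, i)) * v s)))"
    unfolding A quad_form_def using U by (intro sum.cong refl) (simp add: spectral_index sum_distrib_left sum_distrib_right algebra_simps del: index_mult_mat)
  also have "\<dots> = (\<Sum>r<n. \<Sum>i<n. \<Sum>s<n. of_real (d i) * ((cnj (v r) * U $$ (r, i)) * (cnj (U $$ (s, i)) * v s)))"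
    by (intro sum.cong refl sum.swap)
  also have "\<dots> = (\<Sum>i<n. \<Sum>r<n. \<Sum>s<n. of_real (d i) * ((cnj (v r) * U $$ (r, i)) * (cnj (U $$ (s, i)) * v s)))"
    by (rule sum.swap)
  also have "\<dots> = (\<Sum>i<n. of_real (d i) * ((\<Sum>r<n. cnj (v r) * U $$ (r, i)) * cnj (\<Sum>r<n. cnj (v r) * U $$ (r, i))))"
    by (simp add: sum_distrib_left sum_distrib_right sum_product algebra_simps)
  also have "\<dots> = of_real (\<Sum>i<n. d i * (cmod (\<Sum>r<n. cnj (v r) * U $$ (r, i)))\<^sup>2)"
    unfolding complex_norm_square[symmetric] by simp
  finally show ?thesis .
qed

lemma mat_trace_spectral:
  assumes U: "U \<in> carrier_mat n n" "mat_adjoint U * U = 1\<^sub>m n"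
  shows "mat_trace (U * real_diag n d * mat_adjoint U) = of_real (\<Sum>i<n. d i)"
proof -
  have "mat_trace (U * real_diag n d * mat_adjoint U) = (\<Sum>r<n. \<Sum>i<n. of_real (d i) * U $$ (r, i) * cnj (U $$ (r, i)))"
    unfolding mat_trace_def using U(1) by (intro sum.cong) (auto simp: spectral_index simp del: index_mult_mat(1))
  also have "\<dots> = (\<Sum>i<n. of_real (d i) * (\<Sum>r<n. cnj (U $$ (r, i)) * U $$ (r, i)))"
    by (subst sum.swap) (simp add: sum_distrib_left algebra_simps)
  also have "\<dots> = (\<Sum>i<n. of_real (d i))"
  proof (rule sum.cong[OF refl])
    fix i assume i: "i \<in> {..<n}"
    have "(mat_adjoint U * U) $$ (i, i) = (\<Sum>r<n. cnj (U $$ (r, i)) * U $$ (r, i))"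
      using i U(1) by (subst mult_mat_index[of _ n n _ n]) auto
    then show "of_real (d i) * (\<Sum>r<n. cnj (U $$ (r, i)) * U $$ (r, i)) = complex_of_real (d i)"
      using i U(2) by simp
  qed
  finally show ?thesis by simp
qed

text \<open>The definite description in \<open>psd_sqrt\<close> is resolved by exhibiting
  \<open>U |D| U^*\<close> as a positive root and invoking uniqueness. The eigenbasis is exported
  together with the value because later estimates argue in it.\<close>

lemma hermitian_trace_norm:
  assumes A: "A \<in> carrier_mat n n" "mat_adjoint A = A"
  obtains U d where "U \<in> carrier_mat n n" "mat_adjoint U * U = 1\<^sub>m n" "U * mat_adjoint U = 1\<^sub>m n"
    "A = U * real_diag n d * mat_adjoint U" "trace_norm A = (\<Sum>i<n. \<bar>d i\<bar>)"
proof -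
  obtain U d where U: "U \<in> carrier_mat n n" "mat_adjoint U * U = 1\<^sub>m n" "U * mat_adjoint U = 1\<^sub>m n"
    and AU: "A = U * real_diag n d * mat_adjoint U"
    using hermitian_spectral_decomposition[OF A] by blast
  define R where "R = U * real_diag n (\<lambda>i. \<bar>d i\<bar>) * mat_adjoint U"
  have cU: "mat_adjoint U \<in> carrier_mat n n" using U by simp
  have R: "R \<in> carrier_mat n n" unfolding R_def by (rule mult_carrier_mat[OF mult_carrier_mat[OF U(1) real_diag_carrier] cU])
  have psdR: "psd R"
    unfolding psd_iff[OF R] spectral_form[OF U(1) R_def]
    by (auto simp: less_eq_complex_def intro!: sum_nonneg)
  have sq: "(U * real_diag n x * mat_adjoint U) * (U * real_diag n x * mat_adjoint U) = U * real_diag n (\<lambda>i. (x i)\<^sup>2) * mat_adjoint U" for x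
  proof -
    have "(U * real_diag n x * mat_adjoint U) * (U * real_diag n x * mat_adjoint U)
      = U * (real_diag n x * (mat_adjoint U * U) * real_diag n x) * mat_adjoint U"
      using U(1) cU by (simp add: assoc_mult_mat[of _ n n _ n _ n] mult_carrier_mat[of _ n n _ n])
    also have "real_diag n x * (mat_adjoint U * U) * real_diag n x = real_diag n (\<lambda>i. (x i)\<^sup>2)"
    proof (rule eq_matI)
      fix i j assume "i < dim_row (real_diag n (\<lambda>i. (x i)\<^sup>2))" "j < dim_col (real_diag n (\<lambda>i. (x i)\<^sup>2))"
      then have ij: "i < n" "j < n" by (auto simp: real_diag_def)
      have "(real_diag n x * real_diag n x) $$ (i, j) = real_diag n (\<lambda>i. (x i)\<^sup>2) $$ (i, j)"
        using ij by (subst mult_real_diag_index[OF real_diag_carrier ij]) (simp add: real_diag_def power2_eq_square)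
      then show "(real_diag n x * (mat_adjoint U * U) * real_diag n x) $$ (i, j) = real_diag n (\<lambda>i. (x i)\<^sup>2) $$ (i, j)"
        using ij unfolding U(2) by (simp add: right_mult_one_mat[OF real_diag_carrier] del: index_mult_mat(1))
    qed (auto simp: real_diag_def)
    finally show ?thesis .
  qed
  have RR: "R * R = mat_adjoint A * A"
    unfolding A(2) unfolding AU R_def sq by simp
  have "psd_sqrt (mat_adjoint A * A) = R"
    unfolding psd_sqrt_def
  proof (rule the_equality)
    show "R \<in> carrier_mat (dim_row (mat_adjoint A * A)) (dim_row (mat_adjoint A * A)) \<and> psd R \<and> R * R = mat_adjoint A * A"
      using R psdR RR A by auto
  next
    fix S assume "S \<in> carrier_mat (dim_row (mat_adjoint A * A)) (dim_row (mat_adjoint A * A)) \<and> psd S \<and> S * S = mat_adjoint A * A"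
    then show "S = R" using psd_sqrt_unique[of S n R] R psdR RR A by auto
  qed
  then have "trace_norm A = (\<Sum>i<n. \<bar>d i\<bar>)"
    unfolding trace_norm_def R_def using mat_trace_spectral[OF U(1,2)] by simp
  with U AU that show thesis by blast
qed

section \<open>Trace distance between states\<close>

lemma quad_form_minus:
  assumes "A \<in> carrier_mat n n" "B \<in> carrier_mat n n"
  shows "quad_form n (A - B) v = quad_form n A v - quad_form n B v"
  using assms by (simp add: quad_form_def sum_subtractf algebra_simps)

lemma density_operatorsD:
  assumes "\<rho> \<in> density_operators n"
  shows "\<rho> \<in> carrier_mat n n" "psd \<rho>" "mat_trace \<rho> = 1" "mat_adjoint \<rho> = \<rho>"
    "(\<Sum>r<n. \<rho> $$ (r, r)) = 1"
  using assms psd_hermitian unfolding density_operators_def by (auto simp: mat_trace_def)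

text \<open>Equivalent to the sum of the rank-one operators of the family being at most the
  identity, that is, to this sum being a measurement effect. Orthonormal families are the standard
  example.\<close>

definition bessel_family :: "nat \<Rightarrow> 'i set \<Rightarrow> ('i \<Rightarrow> nat \<Rightarrow> complex) \<Rightarrow> bool" where
  "bessel_family n I \<phi> \<longleftrightarrow>
    (\<forall>v. (\<Sum>c\<in>I. (cmod (\<Sum>r<n. cnj (\<phi> c r) * v r))\<^sup>2) \<le> (\<Sum>r<n. (cmod (v r))\<^sup>2))"

lemma column_unit:
  assumes "U \<in> carrier_mat n n" "mat_adjoint U * U = 1\<^sub>m n" "i < n"
  shows "(\<Sum>r<n. (cmod (U $$ (r, i)))\<^sup>2) = 1"
proof -
  have "(mat_adjoint U * U) $$ (i, i) = (\<Sum>r<n. cnj (U $$ (r, i)) * U $$ (r, i))"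
    using assms by (subst mult_mat_index[of _ n n _ n]) auto
  then have "of_real (\<Sum>r<n. (cmod (U $$ (r, i)))\<^sup>2) = (1 :: complex)"
    using assms by (simp add: complex_norm_square[symmetric] mult.commute)
  then show ?thesis using of_real_eq_1_iff by blast
qed

lemma hermitian_minus:
  assumes "A \<in> carrier_mat n n" "mat_adjoint A = A" "B \<in> carrier_mat n n" "mat_adjoint B = B"
  shows "mat_adjoint (A - B) = A - (B :: complex mat)"
proof (rule eq_matI)
  fix i j assume "i < dim_row (A - B)" "j < dim_col (A - B)"
  then have ij: "i < n" "j < n" using assms by auto
  have "A $$ (i, j) = cnj (A $$ (j, i))" "B $$ (i, j) = cnj (B $$ (j, i))"
    using mat_adjoint_index[of i A j] mat_adjoint_index[of i B j] ij assms by auto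
  then show "mat_adjoint (A - B) $$ (i, j) = (A - B) $$ (i, j)" using ij assms by simp
qed (use assms in auto)

text \<open>In an eigenbasis of \<open>P - Q\<close> the eigenvalues are differences of two
  probability distributions, which gives the bound 2. The last part is the Helstrom estimate: an
  effect distinguishes \<open>P\<close> from \<open>Q\<close> by at most half the trace norm, since
  \<open>P - Q\<close> has trace 0.\<close>

lemma trace_norm_diff_bounds:
  assumes P: "P \<in> density_operators n" and Q: "Q \<in> density_operators n"
  shows "0 \<le> trace_norm (P - Q)" "trace_norm (P - Q) \<le> 2"
    and "bessel_family n I \<phi> \<Longrightarrow>
      2 * (\<Sum>c\<in>I. Re (quad_form n P (\<phi> c)) - Re (quad_form n Q (\<phi> c))) \<le> trace_norm (P - Q)"
proof -
  note P' = density_operatorsD[OF P] and Q' = density_operatorsD[OF Q]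
  have X: "P - Q \<in> carrier_mat n n" "mat_adjoint (P - Q) = P - Q"
    using hermitian_minus[OF P'(1,4) Q'(1,4)] P'(1) Q'(1) by auto
  from hermitian_trace_norm[OF X] obtain U d
    where U: "U \<in> carrier_mat n n" "mat_adjoint U * U = 1\<^sub>m n" "U * mat_adjoint U = 1\<^sub>m n"
      and XU: "P - Q = U * real_diag n d * mat_adjoint U" and tn: "trace_norm (P - Q) = (\<Sum>i<n. \<bar>d i\<bar>)" .
  show "0 \<le> trace_norm (P - Q)" unfolding tn by (simp add: sum_nonneg)
  have cU: "mat_adjoint U \<in> carrier_mat n n" using U by simp
  define col where "col i r = U $$ (r, i)" for i r
  have di: "d i = Re (quad_form n P (col i)) - Re (quad_form n Q (col i))" if i: "i < n" for i
  proof -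
    have "mat_adjoint U * (P - Q) * U = (mat_adjoint U * U) * real_diag n d * (mat_adjoint U * U)"
      unfolding XU using U(1) cU by (simp add: assoc_mult_mat[of _ n n _ n _ n] mult_carrier_mat[of _ n n _ n])
    also have "\<dots> = real_diag n d"
      unfolding U(2) by (simp add: left_mult_one_mat[OF real_diag_carrier] right_mult_one_mat[OF real_diag_carrier])
    finally have "(mat_adjoint U * (P - Q) * U) $$ (i, i) = of_real (d i)"
      using i by (simp add: real_diag_def)
    then have "quad_form n (P - Q) (col i) = of_real (d i)"
      using i by (simp add: conj_mat_index[OF X(1) U(1)] quad_form_def col_def)
    then show ?thesis
      unfolding quad_form_minus[OF P'(1) Q'(1)] by (auto dest!: arg_cong[of _ _ Re])
  qed
  have pos: "0 \<le> Re (quad_form n P (col i))" "0 \<le> Re (quad_form n Q (col i))" for i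
    using psd_iff[OF P'(1)] P'(2) psd_iff[OF Q'(1)] Q'(2) by (auto simp: less_eq_complex_def)
  \<comment> \<open>The diagonal of a state in an orthonormal basis sums to its trace; completeness
    of the basis is \<open>U U^* = 1\<close>.\<close>
  have one: "(\<Sum>i<n. Re (quad_form n R (col i))) = 1" if "R \<in> density_operators n" for R
  proof -
    note R = density_operatorsD[OF that]
    have "(\<Sum>i<n. quad_form n R (col i)) = (\<Sum>i<n. \<Sum>r<n. \<Sum>s<n. R $$ (r, s) * (U $$ (s, i) * cnj (U $$ (r, i))))"
      by (simp add: quad_form_def col_def algebra_simps)
    also have "\<dots> = (\<Sum>r<n. \<Sum>i<n. \<Sum>s<n. R $$ (r, s) * (U $$ (s, i) * cnj (U $$ (r, i))))"
      by (rule sum.swap)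
    also have "\<dots> = (\<Sum>r<n. \<Sum>s<n. R $$ (r, s) * (\<Sum>i<n. U $$ (s, i) * cnj (U $$ (r, i))))"
      unfolding sum_distrib_left by (intro sum.cong refl sum.swap)
    also have "\<dots> = (\<Sum>r<n. \<Sum>s<n. R $$ (r, s) * (if s = r then 1 else 0))"
    proof (intro sum.cong refl)
      fix r s assume rs: "r \<in> {..<n}" "s \<in> {..<n}"
      have "(U * mat_adjoint U) $$ (s, r) = (\<Sum>i<n. U $$ (s, i) * cnj (U $$ (r, i)))"
        using rs U(1) by (subst mult_mat_index[OF U(1) cU]) auto
      then show "R $$ (r, s) * (\<Sum>i<n. U $$ (s, i) * cnj (U $$ (r, i))) = R $$ (r, s) * (if s = r then 1 else 0)"
        using rs U(3) by simp
    qed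
    also have "\<dots> = 1" using R(5) by (simp add: if_distrib[of "\<lambda>x. _ * x"] cong: if_cong)
    finally have "Re (\<Sum>i<n. quad_form n R (col i)) = 1" by simp
    then show ?thesis by simp
  qed
  have "trace_norm (P - Q) \<le> (\<Sum>i<n. Re (quad_form n P (col i)) + Re (quad_form n Q (col i)))"
    unfolding tn
  proof (intro sum_mono)
    fix i assume "i \<in> {..<n}"
    then show "\<bar>d i\<bar> \<le> Re (quad_form n P (col i)) + Re (quad_form n Q (col i))"
      using di[of i] pos[of i] by auto
  qed
  also have "\<dots> = 2" using one[OF P] one[OF Q] by (simp add: sum.distrib)
  finally show "trace_norm (P - Q) \<le> 2" .
  assume bessel: "bessel_family n I \<phi>"
  have d0: "(\<Sum>i<n. d i) = 0"
  proof -
    have "(\<Sum>i<n. d i) = (\<Sum>i<n. Re (quad_form n P (col i)) - Re (quad_form n Q (col i)))"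
      by (rule sum.cong) (auto simp: di)
    then show ?thesis by (simp add: sum_subtractf one[OF P] one[OF Q])
  qed
  \<comment> \<open>\<open>t i\<close> is the diagonal entry of the effect at the i-th eigenvector,
    bounded through Bessel by the squared length 1.\<close>
  define t where "t i = (\<Sum>c\<in>I. (cmod (\<Sum>r<n. cnj (\<phi> c r) * U $$ (r, i)))\<^sup>2)" for i
  have t: "0 \<le> t i" "t i \<le> 1" if "i < n" for i
  proof -
    show "0 \<le> t i" unfolding t_def by (simp add: sum_nonneg)
    show "t i \<le> 1"
      using bessel[unfolded bessel_family_def, rule_format, of "\<lambda>r. U $$ (r, i)"] column_unit[OF U(1,2) that]
      unfolding t_def by simp
  qed
  have "(\<Sum>c\<in>I. Re (quad_form n P (\<phi> c)) - Re (quad_form n Q (\<phi> c))) = (\<Sum>c\<in>I. Re (quad_form n (P - Q) (\<phi> c)))"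
    by (simp add: quad_form_minus[OF P'(1) Q'(1)])
  also have "\<dots> = (\<Sum>c\<in>I. \<Sum>i<n. d i * (cmod (\<Sum>r<n. cnj (\<phi> c r) * U $$ (r, i)))\<^sup>2)"
    by (simp only: spectral_form[OF U(1) XU] Re_complex_of_real)
  also have "\<dots> = (\<Sum>i<n. d i * t i)"
    unfolding t_def sum_distrib_left by (rule sum.swap)
  \<comment> \<open>As the eigenvalues sum to 0, the weights \<open>2 * t i\<close> may be shifted
    to \<open>2 * t i - 1\<close>, which lie between -1 and 1. This shift gains the factor
    2.\<close>
  finally have "2 * (\<Sum>c\<in>I. Re (quad_form n P (\<phi> c)) - Re (quad_form n Q (\<phi> c))) = (\<Sum>i<n. d i * (2 * t i - 1))"
    using d0 by (simp add: sum_distrib_left sum_subtractf algebra_simps)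
  also have "\<dots> \<le> (\<Sum>i<n. \<bar>d i\<bar>)"
  proof (rule sum_mono)
    fix i assume "i \<in> {..<n}"
    then have "\<bar>2 * t i - 1\<bar> \<le> 1" using t[of i] by auto
    then have "\<bar>d i * (2 * t i - 1)\<bar> \<le> \<bar>d i\<bar>" by (simp add: abs_mult mult_left_le)
    then show "d i * (2 * t i - 1) \<le> \<bar>d i\<bar>" by linarith
  qed
  finally show "2 * (\<Sum>c\<in>I. Re (quad_form n P (\<phi> c)) - Re (quad_form n Q (\<phi> c))) \<le> trace_norm (P - Q)"
    unfolding tn .
qed

section \<open>Tensor products of superoperators\<close>

lemma pair_index_less: "i < d \<Longrightarrow> k < e \<Longrightarrow> i * e + k < d * (e :: nat)"
  using mult_le_mono1[of "Suc i" d e] by simp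

lemma pair_index_div [simp]: "k < e \<Longrightarrow> (i * e + k) div e = (i :: nat)"
  by simp

lemma pair_index_mod [simp]: "k < e \<Longrightarrow> (i * e + k) mod e = (k :: nat)"
  by simp

lemma div_mod_less:
  assumes "r < d * (e :: nat)" shows "r div e < d" "r mod e < e"
proof -
  show "r div e < d" using assms by (simp add: less_mult_imp_div_less)
  show "r mod e < e" using assms by (metis mod_less_divisor mult_0_right not_gr_zero not_less_zero)
qed

lemma sum_pair_index: "(\<Sum>r<d * e. f r) = (\<Sum>i<d. \<Sum>k<e. f (i * e + k :: nat))"
proof (induction d)
  case (Suc d)
  have eq: "{..<Suc d * e} = {..<d * e} \<union> {d * e..<d * e + e}" by auto
  have "(\<Sum>r<Suc d * e. f r) = (\<Sum>r<d * e. f r) + (\<Sum>r=d * e..<d * e + e. f r)"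
    unfolding eq by (rule sum.union_disjoint) auto
  also have "(\<Sum>r=d * e..<d * e + e. f r) = (\<Sum>k<e. f (d * e + k))"
    using sum.shift_bounds_nat_ivl[of f 0 "d * e" e] by (simp add: add.commute lessThan_atLeast0)
  finally show ?case using Suc by simp
qed simp

lemma mat_unit_carrier [simp]: "mat_unit d i j \<in> carrier_mat d d"
  by (simp add: mat_unit_def)

lemma linear_superop_carrier:
  "linear_superop dX dY L \<Longrightarrow> A \<in> carrier_mat dX dX \<Longrightarrow> L A \<in> carrier_mat dY dY"
  by (simp add: linear_superop_def)

text \<open>Induction on the set of entries that are kept: each further position adds a multiple of
  one matrix unit.\<close>

lemma linear_superop_expand:
  assumes L: "linear_superop dX dY L" and A: "A \<in> carrier_mat dX dX" and rs: "r < dY" "s < dY"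
  shows "L A $$ (r, s) = (\<Sum>i<dX. \<Sum>j<dX. A $$ (i, j) * L (mat_unit dX i j) $$ (r, s))"
proof -
  have L': "\<And>A B. A \<in> carrier_mat dX dX \<Longrightarrow> B \<in> carrier_mat dX dX \<Longrightarrow> L (A + B) = L A + L B"
    "\<And>A c. A \<in> carrier_mat dX dX \<Longrightarrow> L (c \<cdot>\<^sub>m A) = c \<cdot>\<^sub>m L A"
    using L by (auto simp: linear_superop_def)
  define cut where "cut S = mat dX dX (\<lambda>p. if p \<in> S then A $$ p else 0)" for S
  have cut: "cut S \<in> carrier_mat dX dX" for S by (simp add: cut_def)
  have "L (cut S) $$ (r, s) = (\<Sum>(i, j)\<in>S. A $$ (i, j) * L (mat_unit dX i j) $$ (r, s))"
    if "finite S" for S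
    using that
  proof induction
    case empty
    \<comment> \<open>Homogeneity with the scalar 0 supplies the value of \<open>L\<close> at the
      zero matrix.\<close>
    have "cut {} = 0 \<cdot>\<^sub>m A" using A by (auto simp: cut_def intro!: eq_matI)
    then show ?case using L'(2)[OF A, of 0] linear_superop_carrier[OF L A] rs by auto
  next
    case (insert p S)
    obtain i j where p: "p = (i, j)" by (cases p)
    have eq: "cut (insert p S) = A $$ (i, j) \<cdot>\<^sub>m mat_unit dX i j + cut S"
      using insert(2) by (auto simp: cut_def mat_unit_def p intro!: eq_matI)
    have c: "L (mat_unit dX i j) \<in> carrier_mat dY dY" "L (cut S) \<in> carrier_mat dY dY"
      using linear_superop_carrier[OF L] cut by auto
    have "L (cut (insert p S)) $$ (r, s) = A $$ (i, j) * L (mat_unit dX i j) $$ (r, s) + L (cut S) $$ (r, s)"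
      unfolding eq using L' cut c rs by auto
    then show ?case using insert p by simp
  qed
  from this[of "{..<dX} \<times> {..<dX}"]
  have "L (cut ({..<dX} \<times> {..<dX})) $$ (r, s) = (\<Sum>i<dX. \<Sum>j<dX. A $$ (i, j) * L (mat_unit dX i j) $$ (r, s))"
    by (simp add: sum.cartesian_product)
  moreover have "cut ({..<dX} \<times> {..<dX}) = A" using A by (auto simp: cut_def intro!: eq_matI)
  ultimately show ?thesis by simp
qed

definition block :: "nat \<Rightarrow> complex mat \<Rightarrow> nat \<Rightarrow> nat \<Rightarrow> complex mat" where
  "block d \<rho> i j = mat d d (\<lambda>(k, l). \<rho> $$ (i * d + k, j * d + l))"

lemma block_carrier [simp]: "block d \<rho> i j \<in> carrier_mat d d"
  by (simp add: block_def)

lemma tensor_map_carrier [simp]: "tensor_map dX dY L dZ dW M \<rho> \<in> carrier_mat (dY * dW) (dY * dW)"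
  by (simp add: tensor_map_def)

text \<open>Summing over the matrix units of the second factor first applies \<open>M\<close> to
  each block of the argument; summing over those of the first factor then applies \<open>L\<close>
  to the matrix of selected entries. Later entry computations go through this form instead of the
  fourfold sum.\<close>

lemma tensor_map_index:
  assumes L: "linear_superop dX dY L" and M: "linear_superop dZ dW M" and rs: "r < dY * dW" "s < dY * dW"
  shows "tensor_map dX dY L dZ dW M \<rho> $$ (r, s) =
    L (mat dX dX (\<lambda>(i, j). M (block dZ \<rho> i j) $$ (r mod dW, s mod dW))) $$ (r div dW, s div dW)"
proof -
  note b = div_mod_less[OF rs(1)] div_mod_less[OF rs(2)]
  have "tensor_map dX dY L dZ dW M \<rho> $$ (r, s) = (\<Sum>i<dX. \<Sum>j<dX. (\<Sum>k<dZ. \<Sum>l<dZ.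
      \<rho> $$ (i * dZ + k, j * dZ + l) * M (mat_unit dZ k l) $$ (r mod dW, s mod dW)) * L (mat_unit dX i j) $$ (r div dW, s div dW))"
    unfolding tensor_map_def sum_distrib_right
  proof (subst index_mat(1)[OF rs], unfold prod.case, intro sum.cong refl)
    fix i j k l
    have "L (mat_unit dX i j) \<in> carrier_mat dY dY" "M (mat_unit dZ k l) \<in> carrier_mat dW dW"
      using linear_superop_carrier[OF L] linear_superop_carrier[OF M] by auto
    then show "\<rho> $$ (i * dZ + k, j * dZ + l) * kron (L (mat_unit dX i j)) (M (mat_unit dZ k l)) $$ (r, s)
      = \<rho> $$ (i * dZ + k, j * dZ + l) * M (mat_unit dZ k l) $$ (r mod dW, s mod dW) * L (mat_unit dX i j) $$ (r div dW, s div dW)"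
      using rs by (auto simp: kron_def)
  qed
  also have "\<dots> = (\<Sum>i<dX. \<Sum>j<dX. M (block dZ \<rho> i j) $$ (r mod dW, s mod dW) * L (mat_unit dX i j) $$ (r div dW, s div dW))"
  proof (intro sum.cong refl arg_cong2[where f = "(*)"])
    fix i j
    show "(\<Sum>k<dZ. \<Sum>l<dZ. \<rho> $$ (i * dZ + k, j * dZ + l) * M (mat_unit dZ k l) $$ (r mod dW, s mod dW))
      = M (block dZ \<rho> i j) $$ (r mod dW, s mod dW)"
      by (subst linear_superop_expand[OF M block_carrier b(2) b(4)]) (simp add: block_def)
  qed
  also have "\<dots> = L (mat dX dX (\<lambda>(i, j). M (block dZ \<rho> i j) $$ (r mod dW, s mod dW))) $$ (r div dW, s div dW)"
    by (subst (2) linear_superop_expand[OF L _ b(1) b(3)]) auto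
  finally show ?thesis .
qed

lemma linear_superop_id [simp]: "linear_superop d d id_map"
  by (simp add: linear_superop_def id_map_def)

lemma linear_superop_trace [simp]: "linear_superop d 1 trace_map"
  unfolding linear_superop_def trace_map_def mat_trace_def
  by (auto simp: sum.distrib sum_distrib_left intro!: eq_matI)

text \<open>By definition \<open>tensor_map\<close> combines fixed matrices with the entries of the
  argument as coefficients, so linearity is built in. \<open>K\<close> names these fixed
  coefficients to keep the sums readable.\<close>

lemma linear_superop_tensor [simp]: "linear_superop (dX * dZ) (dY * dW) (tensor_map dX dY L dZ dW M)"
  unfolding linear_superop_def
proof (intro conjI ballI allI)
  define K where "K i j k l p = (case p of (r, s) \<Rightarrow> kron (L (mat_unit dX i j)) (M (mat_unit dZ k l)) $$ (r, s))" for i j k l p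
  have t: "tensor_map dX dY L dZ dW M \<rho> = mat (dY * dW) (dY * dW)
     (\<lambda>p. \<Sum>i<dX. \<Sum>j<dX. \<Sum>k<dZ. \<Sum>l<dZ. \<rho> $$ (i * dZ + k, j * dZ + l) * K i j k l p)" for \<rho>
    unfolding tensor_map_def K_def by (rule cong_mat) auto
  fix A B :: "complex mat" assume AB: "A \<in> carrier_mat (dX * dZ) (dX * dZ)" "B \<in> carrier_mat (dX * dZ) (dX * dZ)"
  have "(\<Sum>i<dX. \<Sum>j<dX. \<Sum>k<dZ. \<Sum>l<dZ. (A + B) $$ (i * dZ + k, j * dZ + l) * K i j k l p)
    = (\<Sum>i<dX. \<Sum>j<dX. \<Sum>k<dZ. \<Sum>l<dZ. A $$ (i * dZ + k, j * dZ + l) * K i j k l p + B $$ (i * dZ + k, j * dZ + l) * K i j k l p)" for p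
    using AB by (intro sum.cong refl) (simp add: pair_index_less distrib_right)
  then show "tensor_map dX dY L dZ dW M (A + B) = tensor_map dX dY L dZ dW M A + tensor_map dX dY L dZ dW M B"
    unfolding t by (intro eq_matI) (auto simp: sum.distrib)
next
  define K where "K i j k l p = (case p of (r, s) \<Rightarrow> kron (L (mat_unit dX i j)) (M (mat_unit dZ k l)) $$ (r, s))" for i j k l p
  have t: "tensor_map dX dY L dZ dW M \<rho> = mat (dY * dW) (dY * dW)
     (\<lambda>p. \<Sum>i<dX. \<Sum>j<dX. \<Sum>k<dZ. \<Sum>l<dZ. \<rho> $$ (i * dZ + k, j * dZ + l) * K i j k l p)" for \<rho>
    unfolding tensor_map_def K_def by (rule cong_mat) auto
  fix A :: "complex mat" and c :: complex assume A: "A \<in> carrier_mat (dX * dZ) (dX * dZ)"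
  have "(\<Sum>i<dX. \<Sum>j<dX. \<Sum>k<dZ. \<Sum>l<dZ. (c \<cdot>\<^sub>m A) $$ (i * dZ + k, j * dZ + l) * K i j k l p)
    = (\<Sum>i<dX. \<Sum>j<dX. \<Sum>k<dZ. \<Sum>l<dZ. c * (A $$ (i * dZ + k, j * dZ + l) * K i j k l p))" for p
    using A by (intro sum.cong refl) (simp add: pair_index_less mult.assoc)
  then show "tensor_map dX dY L dZ dW M (c \<cdot>\<^sub>m A) = c \<cdot>\<^sub>m tensor_map dX dY L dZ dW M A"
    unfolding t by (intro eq_matI) (auto simp: sum_distrib_left)
qed simp

lemma linear_superop_comp:
  "linear_superop dX dY L \<Longrightarrow> linear_superop dY dZ M \<Longrightarrow> linear_superop dX dZ (\<lambda>\<rho>. M (L \<rho>))"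
  by (auto simp: linear_superop_def)

lemma linear_superop_diff:
  assumes "linear_superop dX dY L" "linear_superop dX dY M"
  shows "linear_superop dX dY (\<lambda>\<rho>. L \<rho> - M \<rho>)"
  unfolding linear_superop_def
proof (intro conjI ballI allI)
  fix A :: "complex mat" assume A: "A \<in> carrier_mat dX dX"
  then have c: "L A \<in> carrier_mat dY dY" "M A \<in> carrier_mat dY dY" using assms by (auto simp: linear_superop_def)
  then show "L A - M A \<in> carrier_mat dY dY" by auto
  fix z :: complex
  have "L (z \<cdot>\<^sub>m A) = z \<cdot>\<^sub>m L A" "M (z \<cdot>\<^sub>m A) = z \<cdot>\<^sub>m M A" using assms A by (auto simp: linear_superop_def)
  then show "L (z \<cdot>\<^sub>m A) - M (z \<cdot>\<^sub>m A) = z \<cdot>\<^sub>m (L A - M A)"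
    using c by (auto simp: algebra_simps intro!: eq_matI)
next
  fix A B :: "complex mat" assume AB: "A \<in> carrier_mat dX dX" "B \<in> carrier_mat dX dX"
  then have c: "L A \<in> carrier_mat dY dY" "M A \<in> carrier_mat dY dY" "L B \<in> carrier_mat dY dY" "M B \<in> carrier_mat dY dY"
    and "L (A + B) = L A + L B" "M (A + B) = M A + M B"
    using assms by (auto simp: linear_superop_def)
  then show "L (A + B) - M (A + B) = L A - M A + (L B - M B)" by (auto intro!: eq_matI)
qed

lemma linear_superop_cong:
  assumes "\<And>A. A \<in> carrier_mat dX dX \<Longrightarrow> L A = M A"
  shows "linear_superop dX dY L \<longleftrightarrow> linear_superop dX dY M"
  using assms by (simp add: linear_superop_def)

section \<open>Adjoining a reference system\<close>

lemma tensor_id_index: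
  assumes M: "linear_superop dZ dW M" and rs: "r < k * dW" "s < k * dW"
  shows "tensor_map k k id_map dZ dW M \<rho> $$ (r, s) = M (block dZ \<rho> (r div dW) (s div dW)) $$ (r mod dW, s mod dW)"
  using div_mod_less[OF rs(1)] div_mod_less[OF rs(2)]
  by (subst tensor_map_index[OF linear_superop_id M rs]) (simp add: id_map_def)

lemma block_tensor_id:
  assumes M: "linear_superop dZ dW M" and ij: "i < k" "j < k"
  shows "block dW (tensor_map k k id_map dZ dW M \<rho>) i j = M (block dZ \<rho> i j)"
  using linear_superop_carrier[OF M block_carrier, of \<rho> i j] pair_index_less[OF ij(1)] pair_index_less[OF ij(2)]
  by (intro eq_matI) (auto simp: block_def[of dW] tensor_id_index[OF M])

text \<open>Allows the comparison map of the signalling problem to be split, with the reference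
  attached, into a partial trace followed by the unknown channel.\<close>

lemma tensor_id_comp:
  assumes L: "linear_superop dX dY L" and M: "linear_superop dY dZ M"
  shows "tensor_map k k id_map dX dZ (\<lambda>\<rho>. M (L \<rho>)) \<rho> = tensor_map k k id_map dY dZ M (tensor_map k k id_map dX dY L \<rho>)"
    (is "?l = ?r")
proof (rule eq_matI)
  fix r s assume "r < dim_row ?r" "s < dim_col ?r"
  then have rs: "r < k * dZ" "s < k * dZ" by (auto simp: tensor_map_def)
  show "?l $$ (r, s) = ?r $$ (r, s)"
    using div_mod_less[OF rs(1)] div_mod_less[OF rs(2)]
    by (simp add: tensor_id_index[OF linear_superop_comp[OF L M] rs] tensor_id_index[OF M rs] block_tensor_id[OF L])
qed (auto simp: tensor_map_def)

text \<open>Reduces the diamond norm of a difference of channels to trace norms of differences of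
  states.\<close>

lemma tensor_id_diff:
  assumes L: "linear_superop dX dY L" and M: "linear_superop dX dY M"
  shows "tensor_map k k id_map dX dY (\<lambda>\<rho>. L \<rho> - M \<rho>) \<rho>
    = tensor_map k k id_map dX dY L \<rho> - tensor_map k k id_map dX dY M \<rho>" (is "?l = ?r")
proof (rule eq_matI)
  fix r s assume "r < dim_row ?r" "s < dim_col ?r"
  then have rs: "r < k * dY" "s < k * dY" by (auto simp: tensor_map_def)
  have c: "L (block dX \<rho> i j) \<in> carrier_mat dY dY" "M (block dX \<rho> i j) \<in> carrier_mat dY dY" for i j
    using linear_superop_carrier L M by auto
  have "?r $$ (r, s) = tensor_map k k id_map dX dY L \<rho> $$ (r, s) - tensor_map k k id_map dX dY M \<rho> $$ (r, s)"
    using rs by (intro index_minus_mat) (auto simp: tensor_map_def)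
  then show "?l $$ (r, s) = ?r $$ (r, s)"
    using div_mod_less[OF rs(1)] div_mod_less[OF rs(2)] c[of "r div dY" "s div dY"]
    by (simp add: tensor_id_index[OF linear_superop_diff[OF L M] rs] tensor_id_index[OF M rs] tensor_id_index[OF L rs])
qed (auto simp: tensor_map_def)

section \<open>Index maps\<close>

text \<open>Partial traces and permutations of the computational basis are all of this form.\<close>

definition gather :: "'i set \<Rightarrow> nat \<Rightarrow> ('i \<Rightarrow> nat \<Rightarrow> nat) \<Rightarrow> superop" where
  "gather I n f A = mat n n (\<lambda>(r, s). \<Sum>i\<in>I. A $$ (f i r, f i s))"

lemma gather_carrier [simp]: "gather I n f A \<in> carrier_mat n n"
  by (simp add: gather_def)

text \<open>The map is a sum of congruences \<open>V_i^* A V_i\<close>, where \<open>V_i\<close>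
  sends the basis vector \<open>r\<close> to the basis vector \<open>f i r\<close>. Its form at
  \<open>v\<close> is the sum of the forms of \<open>A\<close> at the vectors \<open>V_i v\<close>,
  called \<open>w i\<close> in the proof.\<close>

lemma psd_gather:
  assumes A: "A \<in> carrier_mat m m" "psd A" and f: "\<And>i r. i \<in> I \<Longrightarrow> r < n \<Longrightarrow> f i r < m"
  shows "psd (gather I n f A)"
proof -
  have "0 \<le> quad_form n (gather I n f A) v" for v
  proof -
    define w where "w i k = (\<Sum>r<n. if f i r = k then v r else 0)" for i k
    have w: "(\<Sum>k<m. g k * w i k) = (\<Sum>r<n. g (f i r) * v r)" if "i \<in> I" for i g
    proof -
      have "(\<Sum>k<m. g k * w i k) = (\<Sum>r<n. \<Sum>k<m. if f i r = k then g k * v r else 0)"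
        unfolding w_def sum_distrib_left by (subst sum.swap) (intro sum.cong refl, auto)
      also have "\<dots> = (\<Sum>r<n. g (f i r) * v r)"
        using f[OF that] by (intro sum.cong) auto
      finally show ?thesis .
    qed
    have "quad_form n (gather I n f A) v = (\<Sum>r<n. \<Sum>s<n. \<Sum>i\<in>I. cnj (v r) * (A $$ (f i r, f i s) * v s))"
      unfolding quad_form_def by (intro sum.cong refl) (simp add: gather_def sum_distrib_left sum_distrib_right mult.assoc)
    also have "\<dots> = (\<Sum>r<n. \<Sum>i\<in>I. cnj (v r) * (\<Sum>s<n. A $$ (f i r, f i s) * v s))"
      unfolding sum_distrib_left by (intro sum.cong refl sum.swap)
    also have "\<dots> = (\<Sum>i\<in>I. \<Sum>r<n. cnj (v r) * (\<Sum>s<n. A $$ (f i r, f i s) * v s))"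
      by (rule sum.swap)
    also have "\<dots> = (\<Sum>i\<in>I. \<Sum>r<n. cnj (v r) * (\<Sum>l<m. A $$ (f i r, l) * w i l))"
      by (intro sum.cong refl) (simp only: w)
    also have "\<dots> = (\<Sum>i\<in>I. quad_form m A (w i))"
    proof (intro sum.cong refl)
      fix i assume i: "i \<in> I"
      have "(\<Sum>r<n. cnj (v r) * (\<Sum>l<m. A $$ (f i r, l) * w i l))
        = cnj (\<Sum>r<n. cnj (\<Sum>l<m. A $$ (f i r, l) * w i l) * v r)"
        by (simp add: mult.commute)
      also have "\<dots> = cnj (\<Sum>k<m. cnj (\<Sum>l<m. A $$ (k, l) * w i l) * w i k)"
        using w[OF i, of "\<lambda>k. cnj (\<Sum>l<m. A $$ (k, l) * w i l)"] by simp
      also have "\<dots> = quad_form m A (w i)"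
        by (simp add: quad_form_def sum_distrib_left algebra_simps)
      finally show "(\<Sum>r<n. cnj (v r) * (\<Sum>l<m. A $$ (f i r, l) * w i l)) = quad_form m A (w i)" .
    qed
    also have "0 \<le> \<dots>" using psd_iff[OF A(1)] A(2) by (intro sum_nonneg) auto
    finally show ?thesis .
  qed
  then show ?thesis using psd_iff[OF gather_carrier] by blast
qed

text \<open>Bijectivity means that every diagonal entry of \<open>A\<close> is collected exactly
  once, which preserves the trace. Permutations are the case of a one-element \<open>I\<close>; for
  a partial trace \<open>I\<close> labels the discarded basis.\<close>

lemma gather_density:
  assumes A: "A \<in> density_operators m" and bij: "bij_betw (\<lambda>(i, r). f i r) (I \<times> {..<n}) {..<m}"
  shows "gather I n f A \<in> density_operators n"
proof -
  note A' = density_operatorsD[OF A]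
  have f: "f i r < m" if "i \<in> I" "r < n" for i r using bij_betwE[OF bij] that by auto
  have "mat_trace (gather I n f A) = (\<Sum>r<n. \<Sum>i\<in>I. A $$ (f i r, f i r))"
    by (simp add: mat_trace_def gather_def)
  also have "\<dots> = (\<Sum>p\<in>I \<times> {..<n}. A $$ (case p of (i, r) \<Rightarrow> f i r, case p of (i, r) \<Rightarrow> f i r))"
    by (subst sum.swap) (simp add: sum.cartesian_product case_prod_beta)
  also have "\<dots> = (\<Sum>k<m. A $$ (k, k))"
    using sum.reindex_bij_betw[OF bij, of "\<lambda>k. A $$ (k, k)"] by simp
  finally have "mat_trace (gather I n f A) = 1" using A'(5) by simp
  then show ?thesis using psd_gather[OF A'(1,2) f] by (simp add: density_operators_def)
qed

lemma linear_superop_gather: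
  assumes f: "\<And>i r. i \<in> I \<Longrightarrow> r < n \<Longrightarrow> f i r < m"
  shows "linear_superop m n (gather I n f)"
  unfolding linear_superop_def
proof (intro conjI ballI allI)
  fix A B :: "complex mat" assume AB: "A \<in> carrier_mat m m" "B \<in> carrier_mat m m"
  have "(\<Sum>i\<in>I. (A + B) $$ (f i r, f i s)) = (\<Sum>i\<in>I. A $$ (f i r, f i s) + B $$ (f i r, f i s))"
    if "r < n" "s < n" for r s
    using AB f that by (intro sum.cong refl) simp
  then show "gather I n f (A + B) = gather I n f A + gather I n f B"
    by (intro eq_matI) (auto simp: gather_def sum.distrib)
next
  fix A :: "complex mat" and c assume A: "A \<in> carrier_mat m m"
  have "(\<Sum>i\<in>I. (c \<cdot>\<^sub>m A) $$ (f i r, f i s)) = (\<Sum>i\<in>I. c * A $$ (f i r, f i s))"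
    if "r < n" "s < n" for r s
    using A f that by (intro sum.cong refl) simp
  then show "gather I n f (c \<cdot>\<^sub>m A) = c \<cdot>\<^sub>m gather I n f A"
    by (intro eq_matI) (auto simp: gather_def sum_distrib_left)
qed simp

lemma tensor_id_gather:
  assumes f: "\<And>i r. i \<in> I \<Longrightarrow> r < n \<Longrightarrow> f i r < m"
    and L: "\<And>B. B \<in> carrier_mat m m \<Longrightarrow> L B = gather I n f B"
  shows "tensor_map k k id_map m n L \<rho> = gather I (k * n) (\<lambda>i r. (r div n) * m + f i (r mod n)) \<rho>"
    (is "?l = ?r")
proof (rule eq_matI)
  have lin: "linear_superop m n L"
    using linear_superop_cong[of m L "gather I n f" n] linear_superop_gather[of I n f m] L f by blast
  fix r s assume "r < dim_row ?r" "s < dim_col ?r"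
  then have rs: "r < k * n" "s < k * n" by (auto simp: gather_def)
  show "?l $$ (r, s) = ?r $$ (r, s)"
    using div_mod_less[OF rs(1)] div_mod_less[OF rs(2)] rs f
    by (simp add: tensor_id_index[OF lin rs] L) (auto simp: gather_def block_def intro!: sum.cong)
qed (auto simp: gather_def tensor_map_def)

text \<open>Positivity is complete positivity; the trace is summed over the diagonal blocks, on each
  of which the channel preserves it.\<close>

lemma channel_tensor_density:
  assumes C: "C \<in> channels dX dY" and \<rho>: "\<rho> \<in> density_operators (k * dX)"
  shows "tensor_map k k id_map dX dY C \<rho> \<in> density_operators (k * dY)"
proof -
  have lin: "linear_superop dX dY C" and psd: "psd (tensor_map k k id_map dX dY C \<rho>)"
    and tr: "\<And>B. B \<in> carrier_mat dX dX \<Longrightarrow> mat_trace (C B) = mat_trace B"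
    using C density_operatorsD[OF \<rho>] by (auto simp: channels_def)
  have "mat_trace (tensor_map k k id_map dX dY C \<rho>) = (\<Sum>i<k. \<Sum>j<dY. tensor_map k k id_map dX dY C \<rho> $$ (i * dY + j, i * dY + j))"
    by (simp add: mat_trace_def sum_pair_index carrier_matD(1)[OF tensor_map_carrier])
  also have "\<dots> = (\<Sum>i<k. mat_trace (C (block dX \<rho> i i)))"
  proof (intro sum.cong refl)
    fix i assume "i \<in> {..<k}"
    then have i: "i < k" by simp
    show "(\<Sum>j<dY. tensor_map k k id_map dX dY C \<rho> $$ (i * dY + j, i * dY + j)) = mat_trace (C (block dX \<rho> i i))"
      using linear_superop_carrier[OF lin block_carrier, of \<rho> i i] i pair_index_less[OF i]
      unfolding mat_trace_def by (auto simp: tensor_id_index[OF lin] intro!: sum.cong)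
  qed
  also have "\<dots> = (\<Sum>i<k. \<Sum>j<dX. \<rho> $$ (i * dX + j, i * dX + j))"
    by (simp add: tr) (simp add: mat_trace_def block_def)
  also have "\<dots> = 1" using density_operatorsD(5)[OF \<rho>] by (simp add: sum_pair_index)
  finally show ?thesis using psd by (simp add: density_operators_def)
qed

text \<open>Keeps the sets of channels nonempty, without which an \<open>INF\<close> over the reals
  carries no information.\<close>

lemma id_channel: "id_map \<in> channels d d"
proof -
  have "tensor_map k k id_map d d id_map \<rho> = \<rho>" if "\<rho> \<in> carrier_mat (k * d) (k * d)" for k \<rho>
  proof (rule eq_matI)
    fix r s assume "r < dim_row \<rho>" "s < dim_col \<rho>"
    then have rs: "r < k * d" "s < k * d" using that by auto
    show "tensor_map k k id_map d d id_map \<rho> $$ (r, s) = \<rho> $$ (r, s)"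
      using div_mod_less[OF rs(1)] div_mod_less[OF rs(2)]
      by (simp add: tensor_id_index[OF linear_superop_id rs]) (simp add: id_map_def block_def)
  qed (use that in \<open>auto simp: tensor_map_def\<close>)
  then show ?thesis by (simp add: channels_def) (simp add: id_map_def)
qed

text \<open>A pullback of entries, so \<open>f\<close> runs against the action on basis vectors: for
  a permutation unitary it is the inverse permutation, and compositions reverse the order of the
  index maps. Restriction to the carrier reflects that superoperators are arbitrary
  elsewhere.\<close>

definition relabels :: "nat \<Rightarrow> nat \<Rightarrow> (nat \<Rightarrow> nat) \<Rightarrow> superop \<Rightarrow> bool" where
  "relabels dX dY f L \<longleftrightarrow> (\<forall>r<dY. f r < dX) \<and>
    (\<forall>B \<in> carrier_mat dX dX. L B = mat dY dY (\<lambda>(r, s). B $$ (f r, f s)))"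

lemma relabels_less: "relabels dX dY f L \<Longrightarrow> r < dY \<Longrightarrow> f r < dX"
  by (simp add: relabels_def)

lemma relabels_gather:
  "relabels dX dY f L \<Longrightarrow> B \<in> carrier_mat dX dX \<Longrightarrow> L B = gather {()} dY (\<lambda>_. f) B"
  by (simp add: relabels_def gather_def)

lemma relabels_index:
  "relabels dX dY f L \<Longrightarrow> B \<in> carrier_mat dX dX \<Longrightarrow> r < dY \<Longrightarrow> s < dY \<Longrightarrow> L B $$ (r, s) = B $$ (f r, f s)"
  by (simp add: relabels_def)

lemma relabels_carrier:
  "relabels dX dY f L \<Longrightarrow> B \<in> carrier_mat dX dX \<Longrightarrow> L B \<in> carrier_mat dY dY"
  by (simp add: relabels_def)

lemma relabels_linear:
  assumes "relabels dX dY f L" shows "linear_superop dX dY L"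
  using linear_superop_cong[of dX L "gather {()} dY (\<lambda>_. f)" dY] linear_superop_gather[of "{()}" dY "\<lambda>_. f" dX]
    relabels_gather[OF assms] relabels_less[OF assms] by blast

lemma relabels_cong:
  assumes L: "relabels dX dY f L" and fg: "\<And>r. r < dY \<Longrightarrow> f r = g r"
  shows "relabels dX dY g L"
proof -
  have "mat dY dY (\<lambda>(r, s). B $$ (f r, f s)) = mat dY dY (\<lambda>(r, s). B $$ (g r, g s))" for B :: "complex mat"
    by (rule cong_mat) (auto simp: fg)
  then show ?thesis using L fg by (auto simp: relabels_def)
qed

lemma relabels_id: "relabels d d (\<lambda>r. r) id_map"
  by (auto simp: relabels_def id_map_def intro!: eq_matI)

lemma relabels_comp:
  assumes "relabels dX dY f L" "relabels dY dZ g M"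
  shows "relabels dX dZ (\<lambda>r. f (g r)) (M \<circ> L)"
  unfolding relabels_def
proof (intro conjI allI impI ballI)
  show "f (g r) < dX" if "r < dZ" for r using assms that by (simp add: relabels_less)
  fix B :: "complex mat" assume B: "B \<in> carrier_mat dX dX"
  note LB = relabels_carrier[OF assms(1) B]
  show "(M \<circ> L) B = mat dZ dZ (\<lambda>(r, s). B $$ (f (g r), f (g s)))"
    using relabels_carrier[OF assms(2) LB]
    by (intro eq_matI)
       (auto simp: relabels_index[OF assms(2) LB] relabels_index[OF assms(1) B] relabels_less[OF assms(2)])
qed

lemma relabels_tensor:
  assumes L: "relabels dX dY f L" and M: "relabels dZ dW g M"
  shows "relabels (dX * dZ) (dY * dW) (\<lambda>r. f (r div dW) * dZ + g (r mod dW)) (tensor_map dX dY L dZ dW M)"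
  unfolding relabels_def
proof (intro conjI allI impI ballI)
  show "f (r div dW) * dZ + g (r mod dW) < dX * dZ" if "r < dY * dW" for r
    using div_mod_less[OF that] relabels_less[OF L] relabels_less[OF M] pair_index_less by blast
  fix B :: "complex mat"
  show "tensor_map dX dY L dZ dW M B =
    mat (dY * dW) (dY * dW) (\<lambda>(r, s). B $$ (f (r div dW) * dZ + g (r mod dW), f (s div dW) * dZ + g (s mod dW)))" (is "?l = ?r")
  proof (rule eq_matI)
    fix r s assume "r < dim_row ?r" "s < dim_col ?r"
    then have rs: "r < dY * dW" "s < dY * dW" by auto
    note b = div_mod_less[OF rs(1)] div_mod_less[OF rs(2)]
    show "?l $$ (r, s) = ?r $$ (r, s)"
      unfolding tensor_map_index[OF relabels_linear[OF L] relabels_linear[OF M] rs]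
      using rs b relabels_less[OF L] relabels_less[OF M]
      by (simp add: relabels_index[OF L mat_carrier b(1) b(3)] relabels_index[OF M block_carrier b(2) b(4)])
         (simp add: block_def)
  qed (auto simp: tensor_map_def)
qed

text \<open>An involution makes \<open>L\<close> its own inverse on the carrier, which resolves the
  \<open>inv_into\<close> behind \<open>inverse_superop\<close>.\<close>

lemma relabels_inverse:
  assumes L: "relabels d d f L" and inv: "\<And>r. r < d \<Longrightarrow> f (f r) = r"
  shows "relabels d d f (inverse_superop d L)"
proof -
  have LL: "L (L B) = B" if B: "B \<in> carrier_mat d d" for B
    using relabels_carrier[OF L relabels_carrier[OF L B]] B
    by (intro eq_matI)
       (auto simp: relabels_index[OF L relabels_carrier[OF L B]] relabels_index[OF L B] relabels_less[OF L] inv)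
  have "inj_on L (carrier_mat d d)" by (rule inj_on_inverseI[of _ L]) (simp add: LL)
  then have "inverse_superop d L B = L B" if "B \<in> carrier_mat d d" for B
    unfolding inverse_superop_def using that LL relabels_carrier[OF L]
    by (metis inv_into_f_f)
  then show ?thesis using L by (simp add: relabels_def)
qed

section \<open>Permutations of tensor factors as 0/1 matrices\<close>

definition select_mat :: "nat \<Rightarrow> nat \<Rightarrow> (nat \<Rightarrow> nat) \<Rightarrow> complex mat" where
  "select_mat n m g = mat n m (\<lambda>(r, s). if s = g r then 1 else 0)"

lemma relabels_conj_select:
  assumes g: "\<And>r. r < n \<Longrightarrow> g r < m"
  shows "relabels m n g (conj_map (select_mat n m g))"
  unfolding relabels_def
proof (intro conjI allI impI ballI)
  fix B :: "complex mat" assume B: "B \<in> carrier_mat m m"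
  let ?V = "select_mat n m g"
  have V: "?V \<in> carrier_mat n m" by (simp add: select_mat_def)
  show "conj_map ?V B = mat n n (\<lambda>(r, s). B $$ (g r, g s))" (is "_ = ?r")
  proof (rule eq_matI)
    fix r s assume "r < dim_row ?r" "s < dim_col ?r"
    then have rs: "r < n" "s < n" by auto
    have VB: "(?V * B) $$ (r, l) = B $$ (g r, l)" if l: "l < m" for l
    proof -
      have "(?V * B) $$ (r, l) = (\<Sum>k<m. ?V $$ (r, k) * B $$ (k, l))"
        by (rule mult_mat_index[OF V B rs(1) l])
      also have "\<dots> = (\<Sum>k<m. if k = g r then B $$ (k, l) else 0)"
        using rs by (intro sum.cong) (auto simp: select_mat_def)
      finally show ?thesis using g[OF rs(1)] by simp
    qed
    have "conj_map ?V B $$ (r, s) = (\<Sum>l<m. (?V * B) $$ (r, l) * mat_adjoint ?V $$ (l, s))"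
      unfolding conj_map_def
      by (rule mult_mat_index[OF mult_carrier_mat[OF V B] mat_adjoint_carrier[OF V] rs])
    also have "\<dots> = (\<Sum>l<m. if l = g s then B $$ (g r, l) else 0)"
    proof (intro sum.cong refl)
      fix l assume "l \<in> {..<m}"
      then have l: "l < m" by simp
      have "mat_adjoint ?V $$ (l, s) = (if l = g s then 1 else 0)"
        using l rs V by (subst mat_adjoint_index) (auto simp: select_mat_def)
      then show "(?V * B) $$ (r, l) * mat_adjoint ?V $$ (l, s) = (if l = g s then B $$ (g r, l) else 0)"
        by (simp only: VB[OF l]) simp
    qed
    finally show "conj_map ?V B $$ (r, s) = ?r $$ (r, s)" using g rs by simp
  qed (auto simp: conj_map_def select_mat_def)
qed (rule g)

text \<open>A Kronecker product acts separately on the two mixed-radix digits of an index, and two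
  indices agree exactly when both digits do.\<close>

lemma kron_select_mat:
  assumes g: "\<And>r. r < n \<Longrightarrow> g r < m" and h: "\<And>r. r < n' \<Longrightarrow> h r < m'"
  shows "kron (select_mat n m g) (select_mat n' m' h)
    = select_mat (n * n') (m * m') (\<lambda>r. g (r div n') * m' + h (r mod n'))" (is "?l = ?r")
proof (rule eq_matI)
  fix r s assume "r < dim_row ?r" "s < dim_col ?r"
  then have rs: "r < n * n'" "s < m * m'" by (auto simp: select_mat_def)
  note b = div_mod_less[OF rs(1)] div_mod_less[OF rs(2)]
  have "s = g (r div n') * m' + h (r mod n') \<longleftrightarrow> s div m' = g (r div n') \<and> s mod m' = h (r mod n')"
    using h[OF b(2)] by (metis div_mult_mod_eq pair_index_div pair_index_mod)
  then show "?l $$ (r, s) = ?r $$ (r, s)"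
    using rs b by (simp add: kron_def select_mat_def)
qed (auto simp: kron_def select_mat_def)

lemma one_mat_select: "1\<^sub>m d = select_mat d d (\<lambda>r. r)"
  by (rule eq_matI) (auto simp: select_mat_def)

lemma swap_mat_select: "swap_mat dX dY = select_mat (dY * dX) (dX * dY) (\<lambda>r. (r mod dX) * dY + r div dX)"
proof -
  have "r = (s mod dY) * dX + s div dY \<longleftrightarrow> s = (r mod dX) * dY + r div dX"
    if "r < dY * dX" "s < dX * dY" for r s
    using div_mod_less[OF that(1)] div_mod_less[OF that(2)]
    by (metis div_mult_mod_eq pair_index_div pair_index_mod)
  then show ?thesis by (auto simp: swap_mat_def select_mat_def intro!: eq_matI)
qed

lemma swap_index_less: "r < dY * dX \<Longrightarrow> (r mod dX) * dY + r div dX < dX * (dY :: nat)"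
  using div_mod_less pair_index_less by blast

lemma relabels_swap: "relabels (dX * dY) (dY * dX) (\<lambda>r. (r mod dX) * dY + r div dX) (swap_map dX dY)"
  unfolding swap_map_def swap_mat_select by (rule relabels_conj_select) (rule swap_index_less)

text \<open>The formula is the one that \<open>kron_select_mat\<close> produces for identity, swap
  and identity; \<open>regroup_index_digits\<close> gives its readable form, an exchange of the two
  middle digits.\<close>

definition regroup_index :: "nat \<Rightarrow> nat \<Rightarrow> nat \<Rightarrow> nat \<Rightarrow> nat" where
  "regroup_index d2 d3 d4 r =
    (let q = r div d4; t = q mod (d3 * d2) in
      ((q div (d3 * d2)) * (d2 * d3) + ((t mod d2) * d3 + t div d2)) * d4 + r mod d4)"

lemma relabels_regroup:
  "relabels (d1 * (d2 * d3) * d4) (d1 * (d3 * d2) * d4) (regroup_index d2 d3 d4) (regroup_map d1 d2 d3 d4)"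
proof -
  let ?g = "\<lambda>r. (r div (d3 * d2)) * (d2 * d3) + ((r mod (d3 * d2) mod d2) * d3 + r mod (d3 * d2) div d2)"
  have g: "?g r < d1 * (d2 * d3)" if "r < d1 * (d3 * d2)" for r
    by (rule pair_index_less[OF div_mod_less(1)[OF that] swap_index_less[OF div_mod_less(2)[OF that]]])
  have 1: "kron (1\<^sub>m d1) (swap_mat d2 d3) = select_mat (d1 * (d3 * d2)) (d1 * (d2 * d3)) ?g"
    unfolding swap_mat_select one_mat_select
    by (rule kron_select_mat) (auto intro: swap_index_less)
  have "kron (kron (1\<^sub>m d1) (swap_mat d2 d3)) (1\<^sub>m d4)
    = select_mat (d1 * (d3 * d2) * d4) (d1 * (d2 * d3) * d4) (regroup_index d2 d3 d4)"
    unfolding 1 regroup_index_def Let_def one_mat_select[of d4]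
    by (rule kron_select_mat) (auto intro: g)
  then show ?thesis
    unfolding regroup_map_def
  proof (simp only:, intro relabels_conj_select)
    fix r assume "r < d1 * (d3 * d2) * d4"
    from g[OF div_mod_less(1)[OF this]] div_mod_less(2)[OF this]
    show "regroup_index d2 d3 d4 r < d1 * (d2 * d3) * d4"
      unfolding regroup_index_def Let_def by (rule pair_index_less)
  qed
qed

lemma div_mult_swap: "r div (a * b) = r div b div (a :: nat)"
  by (metis div_mult2_eq mult.commute)

lemma mod_mult_swap: "r mod (a * b) = (r div b mod a) * b + r mod (b :: nat)"
  by (metis mod_mult2_eq mult.commute)

lemma regroup_index_digits:
  assumes "x2 < d2" "x3 < d3" "x4 < d4"
  shows "regroup_index d2 d3 d4 (((x1 * d3 + x3) * d2 + x2) * d4 + x4) = ((x1 * d2 + x2) * d3 + x3) * d4 + x4"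
proof -
  define q where "q = (x1 * d3 + x3) * d2 + x2"
  have "q div (d3 * d2) = x1" "q mod (d3 * d2) = x3 * d2 + x2"
    unfolding q_def div_mult_swap mod_mult_swap using assms by simp_all
  then have "regroup_index d2 d3 d4 (q * d4 + x4) = (x1 * (d2 * d3) + (x2 * d3 + x3)) * d4 + x4"
    using assms by (simp add: regroup_index_def Let_def)
  then show ?thesis unfolding q_def by (simp add: algebra_simps)
qed

lemma obtain_pair:
  assumes "r < d * (e :: nat)" obtains i k where "i < d" "k < e" "r = i * e + k"
  using div_mod_less[OF assms] that[of "r div e" "r mod e"] by simp

lemma obtain_triple:
  assumes "r < d * (e * f :: nat)"
  obtains x y b where "x < d" "y < e" "b < f" "r = (x * e + y) * f + b"
proof -
  from assms have "r < (d * e) * f" by (simp add: mult.assoc)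
  then obtain q b where q: "q < d * e" "b < f" "r = q * f + b" by (rule obtain_pair)
  from q(1) obtain x y where "x < d" "y < e" "q = x * e + y" by (rule obtain_pair)
  with q that show thesis by blast
qed

section \<open>Powers of the CNOT channel\<close>

lemma xor_less_power: "a < 2 ^ n \<Longrightarrow> b < 2 ^ n \<Longrightarrow> xor a b < (2 :: nat) ^ n"
  by (metis take_bit_nat_eq_self_iff take_bit_xor)

text \<open>Each further gate acts on an appended lowest bit, so bitwise xor absorbs the gates one
  at a time.\<close>

lemma xor_append_bit:
  assumes "x < 2" "y < 2" shows "xor (a * 2 + x) (b * 2 + y) = xor a b * 2 + xor x (y :: nat)"
proof -
  have "x = 0 \<or> x = 1" "y = 0 \<or> y = 1" using assms by auto
  then show ?thesis by (subst xor_rec) auto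
qed

lemma xor_xor_cancel [simp]: "xor (xor a b) b = (a :: nat)"
  by (simp add: xor.assoc)

definition cnot_index :: "nat \<Rightarrow> nat \<Rightarrow> nat" where
  "cnot_index N r = xor (r div N) (r mod N) * N + r mod N"

lemma cnot_index_digits: "b < N \<Longrightarrow> cnot_index N (a * N + b) = xor a b * N + b"
  by (simp add: cnot_index_def)

text \<open>The gate is a self-adjoint permutation matrix, so multiplying by it on both sides is a
  conjugation, and pullback and action on labels coincide.\<close>

lemma relabels_CNOT: "relabels 4 4 (cnot_index 2) CNOT_channel"
proof -
  have bits: "r = 0 \<or> r = 1 \<or> r = 2 \<or> r = 3" if "r < 4" for r :: nat using that by auto
  have x: "xor (Suc 0) (Suc 0) = 0" "xor 0 (Suc 0) = Suc 0" "xor (Suc 0) 0 = Suc 0" "xor 0 (0::nat) = 0" by simp_all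
  have CN: "CNOT = select_mat 4 4 (cnot_index 2)"
  proof (rule eq_matI)
    fix r s assume "r < dim_row (select_mat 4 4 (cnot_index 2))" "s < dim_col (select_mat 4 4 (cnot_index 2))"
    then have rs: "r < 4" "s < 4" by (auto simp: select_mat_def)
    show "CNOT $$ (r, s) = select_mat 4 4 (cnot_index 2) $$ (r, s)"
      using bits[OF rs(1)] bits[OF rs(2)] by (elim disjE) (simp_all add: CNOT_def select_mat_def cnot_index_def)
  qed (auto simp: CNOT_def select_mat_def)
  have "mat_adjoint CNOT = CNOT"
  proof (rule eq_matI)
    fix r s assume "r < dim_row CNOT" "s < dim_col CNOT"
    then have rs: "r < 4" "s < 4" by (auto simp: CNOT_def)
    show "mat_adjoint CNOT $$ (r, s) = CNOT $$ (r, s)"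
      using bits[OF rs(1)] bits[OF rs(2)] by (elim disjE) (simp_all add: mat_adjoint_eq CNOT_def)
  qed (auto simp: CNOT_def)
  then have eq: "CNOT_channel = conj_map CNOT" by (auto simp: CNOT_channel_def conj_map_def)
  show ?thesis
    unfolding eq CN
  proof (rule relabels_conj_select)
    fix r :: nat assume "r < 4"
    from bits[OF this] show "cnot_index 2 r < 4" by (elim disjE) (simp_all add: cnot_index_def)
  qed
qed

text \<open>The last pair of qubits supplies the lowest bits: Alice's label is
  \<open>a1 * 2 + a2\<close>, Bob's is \<open>b1 * 2 + b2\<close>. The regroupings bring
  \<open>a1\<close> next to \<open>b1\<close> and \<open>a2\<close> next to \<open>b2\<close>, and
  the two xors recombine by \<open>xor_append_bit\<close>.\<close>

lemma relabels_CNOT_power: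
  "relabels (2 ^ n * 2 ^ n) (2 ^ n * 2 ^ n) (cnot_index (2 ^ n)) (tensor_power 2 2 2 2 CNOT_channel n)"
proof (induction n)
  case 0
  \<comment> \<open>For \<open>n = 0\<close> all systems are one-dimensional and the only index is
    0.\<close>
  show ?case
    by (simp, rule relabels_cong[OF relabels_id]) (simp add: cnot_index_def)
next
  case (Suc n)
  define N :: nat where "N = 2 ^ n"
  let ?P = "tensor_power 2 2 2 2 CNOT_channel n"
  have P: "relabels (N * N) (N * N) (cnot_index N) ?P" using Suc by (simp add: N_def)
  have r1: "relabels (N * (2 * N) * 2) (N * (N * 2) * 2) (regroup_index 2 N 2) (regroup_map N 2 N 2)"
    by (rule relabels_regroup)
  have r2: "relabels (N * (N * 2) * 2) (N * (N * 2) * 2)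
      (\<lambda>r. cnot_index N (r div 4) * 4 + cnot_index 2 (r mod 4))
      (tensor_map (N * N) (N * N) ?P (2 * 2) (2 * 2) CNOT_channel)"
    using relabels_tensor[OF P relabels_CNOT] by (simp add: mult.assoc)
  have r3: "relabels (N * (N * 2) * 2) (N * (2 * N) * 2) (regroup_index N 2 2) (regroup_map N N 2 2)"
    by (rule relabels_regroup)
  have "relabels (N * (2 * N) * 2) (N * (2 * N) * 2)
      (\<lambda>r. regroup_index 2 N 2 (cnot_index N (regroup_index N 2 2 r div 4) * 4 + cnot_index 2 (regroup_index N 2 2 r mod 4)))
      (tensor_power 2 2 2 2 CNOT_channel (Suc n))"
    using relabels_comp[OF relabels_comp[OF r1 r2] r3]
    by (simp add: bipartite_tensor_def N_def comp_assoc)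
  then have "relabels (N * (2 * N) * 2) (N * (2 * N) * 2) (cnot_index (2 * N)) (tensor_power 2 2 2 2 CNOT_channel (Suc n))"
  proof (rule relabels_cong)
    \<comment> \<open>The composite is evaluated on four digits. Since entries are pulled back, the
      index map of the last regrouping acts first.\<close>
    fix r assume "r < N * (2 * N) * 2"
    then obtain a1 a2 b1 b2 where d: "a1 < N" "a2 < 2" "b1 < N" "b2 < 2"
      and r: "r = ((a1 * 2 + a2) * N + b1) * 2 + b2"
    proof -
      assume "r < N * (2 * N) * 2"
      then have "r < (N * 2 * N) * 2" by (simp add: mult.assoc)
      then obtain q b2 where q: "q < N * 2 * N" "b2 < 2" "r = q * 2 + b2" by (rule obtain_pair)
      from q(1) obtain p b1 where p: "p < N * 2" "b1 < N" "q = p * N + b1" by (rule obtain_pair)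
      from p(1) obtain a1 a2 where "a1 < N" "a2 < 2" "p = a1 * 2 + a2" by (rule obtain_pair)
      with q p that show thesis by blast
    qed
    have r': "r = (a1 * 2 + a2) * (2 * N) + (b1 * 2 + b2)" unfolding r by (simp add: algebra_simps)
    have e: "regroup_index N 2 2 r = (a1 * N + b1) * 4 + (a2 * 2 + b2)"
      unfolding r using regroup_index_digits[of b1 N a2 2 b2 2 a1] d by simp
    have "a2 * 2 + b2 < 4" "b1 * 2 + b2 < 2 * N" using d by auto
    have "xor a2 b2 < 2" using xor_less_power[of a2 1 b2] d by simp
    have dm: "regroup_index N 2 2 r div 4 = a1 * N + b1" "regroup_index N 2 2 r mod 4 = a2 * 2 + b2"
      unfolding e using \<open>a2 * 2 + b2 < 4\<close> by (simp_all only: pair_index_div pair_index_mod)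
    have "regroup_index 2 N 2 (cnot_index N (regroup_index N 2 2 r div 4) * 4 + cnot_index 2 (regroup_index N 2 2 r mod 4))
      = regroup_index 2 N 2 (((xor a1 b1 * N + b1) * 2 + xor a2 b2) * 2 + b2)"
      unfolding dm cnot_index_digits[OF d(3)] cnot_index_digits[OF d(4)] by (simp add: algebra_simps)
    also have "\<dots> = ((xor a1 b1 * 2 + xor a2 b2) * N + b1) * 2 + b2"
      using d \<open>xor a2 b2 < 2\<close> by (intro regroup_index_digits)
    also have "\<dots> = cnot_index (2 * N) r"
      unfolding r' cnot_index_digits[OF \<open>b1 * 2 + b2 < 2 * N\<close>] xor_append_bit[OF d(2) d(4)]
      by (simp add: algebra_simps)
    finally show "regroup_index 2 N 2 (cnot_index N (regroup_index N 2 2 r div 4) * 4 + cnot_index 2 (regroup_index N 2 2 r mod 4))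
      = cnot_index (2 * N) r" .
  qed
  then show ?case by (simp add: N_def mult.assoc mult.left_commute)
qed

section \<open>The map T for powers of the CNOT gate\<close>

definition T_index :: "nat \<Rightarrow> nat \<Rightarrow> nat" where
  "T_index N r = (xor (r div N mod N) (r mod N) * N + xor (r div N div N) (r mod N)) * N + r mod N"

lemma T_index_digits:
  "y < N \<Longrightarrow> b < N \<Longrightarrow> T_index N ((x * N + y) * N + b) = (xor y b * N + xor x b) * N + b"
  by (simp add: T_index_def)

text \<open>On labels \<open>(x, y, b)\<close> the factors act in turn by adding \<open>b\<close> to
  the second digit, exchanging the first two digits, and adding \<open>b\<close> to the new second
  digit. The resulting label map is an involution, so pullback and action agree.\<close>

lemma relabels_T_map:
  assumes N: "N = 2 ^ n" and U: "relabels (N * N) (N * N) (cnot_index N) U"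
  shows "relabels (N * N * N) (N * N * N) (T_index N) (T_map N N N N U)"
proof -
  have x: "xor a b < N" if "a < N" "b < N" for a b using xor_less_power that N by simp
  have inv: "cnot_index N (cnot_index N r) = r" if "r < N * N" for r
    using div_mod_less[OF that] by (simp add: cnot_index_def)
  note t1 = relabels_tensor[OF relabels_id[of N] U]
  note t2 = relabels_tensor[OF relabels_swap[of N N] relabels_id[of N]]
  note t3 = relabels_tensor[OF relabels_id[of N] relabels_inverse[OF U inv]]
  have t2': "relabels (N * (N * N)) (N * (N * N)) (\<lambda>r. (r div N mod N * N + r div N div N) * N + r mod N)
      (tensor_map (N * N) (N * N) (swap_map N N) N N id_map)"
    using t2 by (simp add: mult.assoc)
  have "relabels (N * (N * N)) (N * (N * N)) (T_index N) (T_map N N N N U)"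
    unfolding T_map_def
  proof (rule relabels_cong[OF relabels_comp[OF t3 relabels_comp[OF t2' t1]]])
    fix r assume "r < N * (N * N)"
    then obtain x y b where d: "x < N" "y < N" "b < N" and r: "r = (x * N + y) * N + b"
      by (rule obtain_triple)
    \<comment> \<open>\<open>?f1\<close> and \<open>?f2\<close> follow the label through the index
      maps, beginning with the factor that is applied last.\<close>
    let ?f1 = "r div (N * N) * (N * N) + cnot_index N (r mod (N * N))"
    have f1: "?f1 = (x * N + xor y b) * N + b"
      unfolding r using d by (simp add: div_mult_swap mod_mult_swap cnot_index_digits) (simp add: algebra_simps)
    let ?f2 = "(?f1 div N mod N * N + ?f1 div N div N) * N + ?f1 mod N"
    have f2: "?f2 = (xor y b * N + x) * N + b" unfolding f1 using d x by simp
    show "?f2 div (N * N) * (N * N) + cnot_index N (?f2 mod (N * N)) = T_index N r"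
      unfolding f2 unfolding r using d x
      by (simp add: div_mult_swap mod_mult_swap cnot_index_digits T_index_digits) (simp add: algebra_simps)
  qed
  then show ?thesis by (simp add: mult.assoc)
qed

section \<open>Bounds on signalling and causal influence\<close>

definition pure_state :: "nat \<Rightarrow> (nat \<Rightarrow> complex) \<Rightarrow> complex mat" where
  "pure_state n \<psi> = mat n n (\<lambda>(r, s). \<psi> r * cnj (\<psi> s))"

lemma quad_form_outer_sum:
  assumes "\<And>r s. r < n \<Longrightarrow> s < n \<Longrightarrow> A $$ (r, s) = (\<Sum>i\<in>I. \<psi> i r * cnj (\<psi> i s))"
  shows "quad_form n A v = of_real (\<Sum>i\<in>I. (cmod (\<Sum>r<n. cnj (v r) * \<psi> i r))\<^sup>2)"
proof -
  have "quad_form n A v = (\<Sum>r<n. \<Sum>s<n. \<Sum>i\<in>I. (cnj (v r) * \<psi> i r) * cnj (cnj (v s) * \<psi> i s))"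
    unfolding quad_form_def using assms
    by (intro sum.cong refl) (simp add: sum_distrib_left sum_distrib_right mult.assoc, simp add: mult.commute mult.left_commute)
  also have "\<dots> = (\<Sum>r<n. \<Sum>i\<in>I. \<Sum>s<n. (cnj (v r) * \<psi> i r) * cnj (cnj (v s) * \<psi> i s))"
    by (intro sum.cong refl sum.swap)
  also have "\<dots> = (\<Sum>i\<in>I. \<Sum>r<n. \<Sum>s<n. (cnj (v r) * \<psi> i r) * cnj (cnj (v s) * \<psi> i s))"
    by (rule sum.swap)
  also have "\<dots> = (\<Sum>i\<in>I. (\<Sum>r<n. cnj (v r) * \<psi> i r) * cnj (\<Sum>r<n. cnj (v r) * \<psi> i r))"
    unfolding sum_product cnj_sum ..
  finally show ?thesis by (simp only: complex_norm_square[symmetric] of_real_sum of_real_power)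
qed

lemma pure_state_density:
  assumes "(\<Sum>r<n. (cmod (\<psi> r))\<^sup>2) = 1"
  shows "pure_state n \<psi> \<in> density_operators n"
proof -
  have c: "pure_state n \<psi> \<in> carrier_mat n n" by (simp add: pure_state_def)
  have "quad_form n (pure_state n \<psi>) v = of_real (\<Sum>i\<in>{()}. (cmod (\<Sum>r<n. cnj (v r) * \<psi> r))\<^sup>2)" for v
    by (rule quad_form_outer_sum) (simp add: pure_state_def)
  then have "psd (pure_state n \<psi>)"
    unfolding psd_iff[OF c] by (simp add: less_eq_complex_def)
  moreover have "mat_trace (pure_state n \<psi>) = of_real (\<Sum>r<n. (cmod (\<psi> r))\<^sup>2)"
    by (simp add: mat_trace_def pure_state_def complex_norm_square[symmetric])
  ultimately show ?thesis using c assms by (simp add: density_operators_def)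
qed

text \<open>A partial trace of a pure state is a mixture of the unnormalised vectors
  \<open>\<psi> \<circ> f i\<close>, so the form becomes a sum of squared overlaps.\<close>

lemma quad_form_gather_pure:
  assumes "\<And>i r. i \<in> I \<Longrightarrow> r < n \<Longrightarrow> f i r < m"
  shows "quad_form n (gather I n f (pure_state m \<psi>)) v = of_real (\<Sum>i\<in>I. (cmod (\<Sum>r<n. cnj (v r) * \<psi> (f i r)))\<^sup>2)"
  using assms by (intro quad_form_outer_sum) (simp add: gather_def pure_state_def)

text \<open>Both maps send states to states, so every trace norm in the supremum is at most 2; this
  boundedness is what lets a particular state bound the supremum from below. The same state shows
  that the supremum is taken over a nonempty set.\<close>

lemma diamond_norm_diff_bounds:
  assumes L: "linear_superop dX dY L" "linear_superop dX dY M"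
    and P: "\<And>\<rho>. \<rho> \<in> density_operators (dX * dX) \<Longrightarrow> tensor_map dX dX id_map dX dY L \<rho> \<in> density_operators (dX * dY)"
    and Q: "\<And>\<rho>. \<rho> \<in> density_operators (dX * dX) \<Longrightarrow> tensor_map dX dX id_map dX dY M \<rho> \<in> density_operators (dX * dY)"
    and \<rho>: "\<rho> \<in> density_operators (dX * dX)"
  shows "0 \<le> diamond_norm dX dY (\<lambda>\<rho>. L \<rho> - M \<rho>)" "diamond_norm dX dY (\<lambda>\<rho>. L \<rho> - M \<rho>) \<le> 2"
    and "bessel_family (dX * dY) I \<phi> \<Longrightarrow>
      2 * (\<Sum>c\<in>I. Re (quad_form (dX * dY) (tensor_map dX dX id_map dX dY L \<rho>) (\<phi> c))
        - Re (quad_form (dX * dY) (tensor_map dX dX id_map dX dY M \<rho>) (\<phi> c)))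
      \<le> diamond_norm dX dY (\<lambda>\<rho>. L \<rho> - M \<rho>)"
proof -
  let ?t = "\<lambda>\<rho>. trace_norm (tensor_map dX dX id_map dX dY (\<lambda>\<rho>. L \<rho> - M \<rho>) \<rho>)"
  note eq = tensor_id_diff[OF L, of dX]
  have d: "?t \<rho> \<le> 2" if "\<rho> \<in> density_operators (dX * dX)" for \<rho>
    unfolding eq by (rule trace_norm_diff_bounds(2)[OF P Q]) (use that in auto)
  have bdd: "bdd_above (?t ` density_operators (dX * dX))"
    by (rule bdd_aboveI2[of _ _ 2]) (rule d)
  have up: "?t \<rho> \<le> diamond_norm dX dY (\<lambda>\<rho>. L \<rho> - M \<rho>)"
    unfolding diamond_norm_def by (rule cSUP_upper[OF \<rho> bdd])
  show "0 \<le> diamond_norm dX dY (\<lambda>\<rho>. L \<rho> - M \<rho>)" using trace_norm_diff_bounds(1)[OF P[OF \<rho>] Q[OF \<rho>]] up unfolding eq by linarith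
  show "diamond_norm dX dY (\<lambda>\<rho>. L \<rho> - M \<rho>) \<le> 2"
    unfolding diamond_norm_def by (rule cSUP_least) (use \<rho> d in auto)
  assume "bessel_family (dX * dY) I \<phi>"
  from trace_norm_diff_bounds(3)[OF P[OF \<rho>] Q[OF \<rho>] this] up show "2 * (\<Sum>c\<in>I. Re (quad_form (dX * dY) (tensor_map dX dX id_map dX dY L \<rho>) (\<phi> c))
        - Re (quad_form (dX * dY) (tensor_map dX dX id_map dX dY M \<rho>) (\<phi> c)))
      \<le> diamond_norm dX dY (\<lambda>\<rho>. L \<rho> - M \<rho>)" unfolding eq by linarith
qed

text \<open>The vector \<open>N\<^sup>-\<^sup>1\<^sup>/\<^sup>2 \<Sum>\<^sub>b g(b) |h(b)\<rangle> \<otimes> |b\<rangle>\<close>.\<close>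

definition graph_vec :: "nat \<Rightarrow> (nat \<Rightarrow> nat) \<Rightarrow> (nat \<Rightarrow> complex) \<Rightarrow> nat \<Rightarrow> complex" where
  "graph_vec N h g r = (if r div N = h (r mod N) then g (r mod N) / of_real (sqrt (real N)) else 0)"

section \<open>Test vectors supported on graphs\<close>

lemma sum_graph:
  fixes F :: "nat \<Rightarrow> 'a :: comm_monoid_add"
  assumes "\<And>b. b < N \<Longrightarrow> h b < D"
  shows "(\<Sum>r<D * N. if r div N = h (r mod N) then F r else 0) = (\<Sum>b<N. F (h b * N + b))"
proof -
  have "(\<Sum>r<D * N. if r div N = h (r mod N) then F r else 0) = (\<Sum>b<N. \<Sum>i<D. if i = h b then F (h b * N + b) else 0)"
    unfolding sum_pair_index by (subst sum.swap) (intro sum.cong refl, auto)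
  also have "\<dots> = (\<Sum>b<N. F (h b * N + b))"
    using assms by (intro sum.cong) auto
  finally show ?thesis .
qed

lemma inner_graph_vec:
  assumes "\<And>b. b < N \<Longrightarrow> h b < D"
  shows "(\<Sum>r<D * N. cnj (graph_vec N h g r) * v r) = (\<Sum>b<N. cnj (g b) * v (h b * N + b)) / of_real (sqrt (real N))"
proof -
  have "(\<Sum>r<D * N. cnj (graph_vec N h g r) * v r)
    = (\<Sum>r<D * N. if r div N = h (r mod N) then cnj (g (r mod N)) * v r / of_real (sqrt (real N)) else 0)"
    by (intro sum.cong) (auto simp: graph_vec_def)
  also have "\<dots> = (\<Sum>b<N. cnj (g b) * v (h b * N + b) / of_real (sqrt (real N)))"
    by (subst sum_graph[OF assms]) (auto intro!: sum.cong)
  finally show ?thesis by (simp add: sum_divide_distrib)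
qed

lemma quad_form_graph_vec:
  assumes h: "\<And>b. b < N \<Longrightarrow> h b < D"
  shows "quad_form (D * N) A (graph_vec N h g)
    = (\<Sum>b<N. \<Sum>b'<N. cnj (g b) * A $$ (h b * N + b, h b' * N + b') * g b') / of_nat N"
proof -
  have sq: "complex_of_real (sqrt (real N)) * complex_of_real (sqrt (real N)) = of_nat N"
    by (simp flip: of_real_mult)
  have ig: "(\<Sum>r<D * N. cnj (graph_vec N h g r) * v r) = (\<Sum>b<N. cnj (g b) * v (h b * N + b)) / of_real (sqrt (real N))" for v
    by (rule inner_graph_vec) (rule h)
  have inner: "(\<Sum>s<D * N. A $$ (r, s) * graph_vec N h g s) = (\<Sum>b'<N. A $$ (r, h b' * N + b') * g b') / of_real (sqrt (real N))" for r
  proof -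
    have "(\<Sum>s<D * N. A $$ (r, s) * graph_vec N h g s) = cnj (\<Sum>s<D * N. cnj (graph_vec N h g s) * cnj (A $$ (r, s)))"
      by (simp add: mult.commute)
    also have "\<dots> = (\<Sum>b'<N. A $$ (r, h b' * N + b') * g b') / of_real (sqrt (real N))"
      unfolding ig by (simp add: mult.commute)
    finally show ?thesis .
  qed
  have "quad_form (D * N) A (graph_vec N h g)
    = (\<Sum>r<D * N. cnj (graph_vec N h g r) * (\<Sum>s<D * N. A $$ (r, s) * graph_vec N h g s))"
    by (simp add: quad_form_def sum_distrib_left mult.assoc)
  also have "\<dots> = (\<Sum>b<N. cnj (g b) * (\<Sum>b'<N. A $$ (h b * N + b, h b' * N + b') * g b')) / of_nat N"
    unfolding inner ig sq[symmetric] by (simp add: sum_divide_distrib[symmetric])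
  finally show ?thesis by (simp add: sum_distrib_left mult.assoc)
qed

text \<open>Cauchy-Schwarz against the constant vector, from the nonnegativity of the sum of all
  \<open>(|x b| - |x c|)^2\<close>.\<close>

lemma cmod_sum_squared_le: "(cmod (\<Sum>b<N. x b))\<^sup>2 \<le> real N * (\<Sum>b<N. (cmod (x b))\<^sup>2)"
proof -
  have sq: "(\<Sum>b<N. \<Sum>c<N. 2 * (cmod (x b) * cmod (x c))) = 2 * (\<Sum>b<N. cmod (x b))\<^sup>2"
    unfolding power2_eq_square sum_product by (simp add: sum_distrib_left)
  have "0 \<le> (\<Sum>b<N. \<Sum>c<N. (cmod (x b) - cmod (x c))\<^sup>2)" by (intro sum_nonneg) simp
  also have "\<dots> = (\<Sum>b<N. \<Sum>c<N. (cmod (x b))\<^sup>2 + (cmod (x c))\<^sup>2 - 2 * (cmod (x b) * cmod (x c)))"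
    by (simp add: power2_diff mult.assoc)
  also have "\<dots> = 2 * (real N * (\<Sum>b<N. (cmod (x b))\<^sup>2)) - 2 * (\<Sum>b<N. cmod (x b))\<^sup>2"
    by (simp add: sum.distrib sum_subtractf sq sum_distrib_left[where r = "real N"])
  finally have "(\<Sum>b<N. cmod (x b))\<^sup>2 \<le> real N * (\<Sum>b<N. (cmod (x b))\<^sup>2)" by simp
  moreover have "(cmod (\<Sum>b<N. x b))\<^sup>2 \<le> (\<Sum>b<N. cmod (x b))\<^sup>2"
    by (intro power_mono norm_sum) simp
  ultimately show ?thesis by linarith
qed

text \<open>Injectivity in \<open>c\<close> makes the graphs of the functions \<open>h c\<close>
  disjoint, hence the vectors have disjoint supports. By Cauchy-Schwarz each squared overlap is at
  most the mass of \<open>v\<close> on its graph, and these masses add up to at most the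
  total.\<close>

lemma bessel_graph_vec:
  assumes I: "finite I" and N: "0 < N" and h: "\<And>c b. c \<in> I \<Longrightarrow> b < N \<Longrightarrow> h c b < D"
    and inj: "\<And>b. b < N \<Longrightarrow> inj_on (\<lambda>c. h c b) I"
    and g: "\<And>c b. b < N \<Longrightarrow> cmod (g c b) = 1"
  shows "bessel_family (D * N) I (\<lambda>c. graph_vec N (h c) (g c))"
  unfolding bessel_family_def
proof
  fix v :: "nat \<Rightarrow> complex"
  have "(\<Sum>c\<in>I. (cmod (\<Sum>r<D * N. cnj (graph_vec N (h c) (g c) r) * v r))\<^sup>2)
    \<le> (\<Sum>c\<in>I. \<Sum>b<N. (cmod (v (h c b * N + b)))\<^sup>2)"
  proof (intro sum_mono)
    fix c assume c: "c \<in> I"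
    have "(cmod (\<Sum>r<D * N. cnj (graph_vec N (h c) (g c) r) * v r))\<^sup>2
      = (cmod (\<Sum>b<N. cnj (g c b) * v (h c b * N + b)))\<^sup>2 / real N"
      by (subst inner_graph_vec[of N "h c" D]) (use h c in \<open>auto simp: norm_divide power_divide\<close>)
    also have "\<dots> \<le> (\<Sum>b<N. (cmod (cnj (g c b) * v (h c b * N + b)))\<^sup>2)"
      using cmod_sum_squared_le[of "\<lambda>b. cnj (g c b) * v (h c b * N + b)" N] N by (simp add: field_simps)
    also have "\<dots> = (\<Sum>b<N. (cmod (v (h c b * N + b)))\<^sup>2)"
      by (intro sum.cong) (auto simp: norm_mult g)
    finally show "(cmod (\<Sum>r<D * N. cnj (graph_vec N (h c) (g c) r) * v r))\<^sup>2 \<le> (\<Sum>b<N. (cmod (v (h c b * N + b)))\<^sup>2)" .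
  qed
  also have "\<dots> = (\<Sum>p\<in>I \<times> {..<N}. (cmod (v (h (fst p) (snd p) * N + snd p)))\<^sup>2)"
    by (simp add: sum.cartesian_product case_prod_beta)
  also have "\<dots> = (\<Sum>r\<in>(\<lambda>p. h (fst p) (snd p) * N + snd p) ` (I \<times> {..<N}). (cmod (v r))\<^sup>2)"
  proof (subst sum.reindex)
    show "inj_on (\<lambda>p. h (fst p) (snd p) * N + snd p) (I \<times> {..<N})"
    proof (rule inj_onI)
      fix p q assume pq: "p \<in> I \<times> {..<N}" "q \<in> I \<times> {..<N}"
        and eq: "h (fst p) (snd p) * N + snd p = h (fst q) (snd q) * N + snd q"
      have s: "snd p = snd q"
        using arg_cong[OF eq, of "\<lambda>r. r mod N"] pq by auto
      have "h (fst p) (snd p) = h (fst q) (snd q)"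
        using arg_cong[OF eq, of "\<lambda>r. r div N"] pq by auto
      then have "fst p = fst q" using inj[of "snd p"] pq s by (auto dest: inj_onD)
      with s show "p = q" by (simp add: prod_eq_iff)
    qed
  qed simp
  also have "\<dots> \<le> (\<Sum>r<D * N. (cmod (v r))\<^sup>2)"
    using h by (intro sum_mono2) (auto intro: pair_index_less)
  finally show "(\<Sum>c\<in>I. (cmod (\<Sum>r<D * N. cnj (graph_vec N (h c) (g c) r) * v r))\<^sup>2) \<le> (\<Sum>r<D * N. (cmod (v r))\<^sup>2)" .
qed

section \<open>Signalling of the CNOT powers\<close>

lemma tensor_map_cong:
  assumes "\<And>B. B \<in> carrier_mat dZ dZ \<Longrightarrow> M B = M' B"
  shows "tensor_map dX dY L dZ dW M \<rho> = tensor_map dX dY L dZ dW M' \<rho>"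
  using assms by (simp add: tensor_map_def)

lemma trace_tensor_index:
  assumes M: "linear_superop dZ dW M" and rs: "r < dW" "s < dW"
  shows "tensor_map dX 1 trace_map dZ dW M \<rho> $$ (r, s) = (\<Sum>i<dX. M (block dZ \<rho> i i) $$ (r, s))"
  using rs by (subst tensor_map_index[OF linear_superop_trace M]) (simp_all add: trace_map_def mat_trace_def)

text \<open>The test cannot see which channel competes: once \<open>A\<close> is discarded, the
  reference is maximally mixed on \<open>N\<close> labels, so the overlap with each test vector
  depends on the channel only through the trace of its output. Each of the \<open>N\<close> vectors
  then contributes at least \<open>1/N - 1/N^2\<close>.\<close>

lemma signalling_bounds:
  assumes N: "N = 2 ^ n" and U: "relabels (N * N) (N * N) (cnot_index N) U"
  shows "2 - 2 / real N \<le> signalling N N N N U" "signalling N N N N U \<le> 2"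
proof -
  have N0: "0 < N" unfolding N by simp
  have x: "xor a b < N" if "a < N" "b < N" for a b using xor_less_power that N by simp
  let ?d = "N * N" and ?m = "N * N * (N * N)" and ?k = "N * N * N"
  define L where "L \<rho> = tensor_map N 1 trace_map N N id_map (U \<rho>)" for \<rho>
  define M where "M C \<rho> = tensor_map N 1 trace_map N N C \<rho>" for C \<rho>
  have linL: "linear_superop ?d N L"
    unfolding L_def using linear_superop_comp[OF relabels_linear[OF U] linear_superop_tensor[of N N 1 N trace_map id_map]] by simp
  have linM: "linear_superop ?d N (M C)" for C
    unfolding M_def using linear_superop_tensor[of N N 1 N trace_map C] by simp
  \<comment> \<open>The gate is its own inverse, so the output label \<open>(i, b)\<close> on
    \<open>A'\<close> and \<open>B'\<close> is read from the input label
    \<open>(xor i b, b)\<close>; the reference digit is kept.\<close>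
  define f where "f i r = (r div N) * ?d + cnot_index N (i * N + r mod N)" for i r
  have f_digits: "f i (e * N + b) = e * ?d + (xor i b * N + b)" if "b < N" for i e b
    using that by (simp add: f_def cnot_index_digits)
  have cn: "cnot_index N (i * N + b) < ?d" if "i < N" "b < N" for i b
    using that x by (simp add: cnot_index_digits pair_index_less)
  have L_gather: "L B = gather {..<N} N (\<lambda>i r. cnot_index N (i * N + r)) B" if B: "B \<in> carrier_mat ?d ?d" for B
  proof (rule eq_matI)
    fix r s assume "r < dim_row (gather {..<N} N (\<lambda>i r. cnot_index N (i * N + r)) B)"
      "s < dim_col (gather {..<N} N (\<lambda>i r. cnot_index N (i * N + r)) B)"
    then have rs: "r < N" "s < N" by (auto simp: gather_def)
    have "L B $$ (r, s) = (\<Sum>i<N. id_map (block N (U B) i i) $$ (r, s))"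
      unfolding L_def by (rule trace_tensor_index[OF linear_superop_id rs])
    also have "\<dots> = (\<Sum>i<N. B $$ (cnot_index N (i * N + r), cnot_index N (i * N + s)))"
      using rs by (intro sum.cong refl) (simp add: id_map_def block_def relabels_index[OF U B] pair_index_less)
    finally show "L B $$ (r, s) = gather {..<N} N (\<lambda>i r. cnot_index N (i * N + r)) B $$ (r, s)"
      using rs by (simp add: gather_def)
  qed (use linear_superop_carrier[OF linL B] in \<open>auto simp: gather_def\<close>)
  have P: "tensor_map ?d ?d id_map ?d N L \<rho> = gather {..<N} ?k f \<rho>" for \<rho>
    unfolding f_def by (rule tensor_id_gather) (use cn L_gather in auto)
  have f_less: "f i r < ?m" if "i < N" "r < ?k" for i r
    using div_mod_less[OF that(2)] cn[OF that(1)] unfolding f_def by (auto intro: pair_index_less)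
  have Pd: "gather {..<N} ?k f \<rho> \<in> density_operators ?k" if "\<rho> \<in> density_operators ?m" for \<rho>
  proof (rule gather_density[OF that], rule bij_betw_byWitness)
    \<comment> \<open>Inverse of \<open>f\<close>: the discarded value of \<open>A'\<close> is
      recovered as the xor of the two input labels.\<close>
    let ?w = "\<lambda>t. (xor (t div N mod N) (t mod N), (t div ?d) * N + t mod N)"
    show "\<forall>p\<in>{..<N} \<times> {..<?k}. ?w (case p of (i, r) \<Rightarrow> f i r) = p"
    proof
      fix p assume "p \<in> {..<N} \<times> {..<?k}"
      then obtain i r where p: "p = (i, r)" "i < N" "r < ?k" by auto
      from p(3) obtain e b where r: "e < ?d" "b < N" "r = e * N + b" by (rule obtain_pair)
      have "f i r = (e * N + xor i b) * N + b" unfolding r(3) f_digits[OF r(2)] by (simp add: algebra_simps)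
      then show "?w (case p of (i, r) \<Rightarrow> f i r) = p"
        using p r x by (simp add: div_mult_swap)
    qed
    show "\<forall>t\<in>{..<?m}. (case ?w t of (i, r) \<Rightarrow> f i r) = t"
    proof
      fix t assume "t \<in> {..<?m}"
      then obtain e a b where t: "e < ?d" "a < N" "b < N" "t = (e * N + a) * N + b"
        by (auto elim: obtain_triple)
      show "(case ?w t of (i, r) \<Rightarrow> f i r) = t"
        unfolding t(4) using t x by (simp add: div_mult_swap f_digits) (simp add: algebra_simps)
    qed
    show "(\<lambda>(i, r). f i r) ` ({..<N} \<times> {..<?k}) \<subseteq> {..<?m}" using f_less by auto
    show "?w ` {..<?m} \<subseteq> {..<N} \<times> {..<?k}"
    proof
      fix p assume "p \<in> ?w ` {..<?m}"
      then obtain t where t: "t < ?m" "p = ?w t" by auto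
      have "xor (t div N mod N) (t mod N) < N" using x N0 by simp
      moreover have "t div ?d * N + t mod N < ?k"
        using div_mod_less(1)[OF t(1)] N0 by (intro pair_index_less) auto
      ultimately show "p \<in> {..<N} \<times> {..<?k}" unfolding t(2) by simp
    qed
  qed
  define h where "h i r = (r div N) * ?d + (i * N + r mod N)" for i r
  \<comment> \<open>Linearity of \<open>C\<close> moves the sum over the labels of \<open>A\<close>
    inside, so that \<open>C\<close> acts once on the partial trace.\<close>
  have M_gather: "M C B = C (gather {..<N} N (\<lambda>i r. i * N + r) B)"
    if C: "linear_superop N N C" and B: "B \<in> carrier_mat ?d ?d" for C B
  proof (rule eq_matI)
    let ?G = "gather {..<N} N (\<lambda>i r. i * N + r) B"
    have G: "C ?G \<in> carrier_mat N N" using linear_superop_carrier[OF C] by simp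
    fix r s assume "r < dim_row (C ?G)" "s < dim_col (C ?G)"
    then have rs: "r < N" "s < N" using G by auto
    have "M C B $$ (r, s) = (\<Sum>i<N. C (block N B i i) $$ (r, s))"
      unfolding M_def by (rule trace_tensor_index[OF C rs])
    also have "\<dots> = (\<Sum>i<N. \<Sum>k<N. \<Sum>l<N. block N B i i $$ (k, l) * C (mat_unit N k l) $$ (r, s))"
      by (intro sum.cong refl linear_superop_expand[OF C block_carrier rs])
    also have "\<dots> = (\<Sum>k<N. \<Sum>i<N. \<Sum>l<N. block N B i i $$ (k, l) * C (mat_unit N k l) $$ (r, s))"
      by (rule sum.swap)
    also have "\<dots> = (\<Sum>k<N. \<Sum>l<N. \<Sum>i<N. block N B i i $$ (k, l) * C (mat_unit N k l) $$ (r, s))"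
      by (intro sum.cong refl sum.swap)
    also have "\<dots> = (\<Sum>k<N. \<Sum>l<N. ?G $$ (k, l) * C (mat_unit N k l) $$ (r, s))"
      by (intro sum.cong refl) (simp add: gather_def block_def sum_distrib_right)
    also have "\<dots> = C ?G $$ (r, s)"
      by (rule linear_superop_expand[OF C _ rs, symmetric]) simp
    finally show "M C B $$ (r, s) = C ?G $$ (r, s)" .
  qed (simp_all add: carrier_matD[OF linear_superop_carrier[OF linM B]] carrier_matD[OF linear_superop_carrier[OF C gather_carrier]])
  have Q: "tensor_map ?d ?d id_map ?d N (M C) \<rho> = tensor_map ?d ?d id_map N N C (gather {..<N} ?k h \<rho>)"
    if C: "linear_superop N N C" for C \<rho>
  proof -
    have "tensor_map ?d ?d id_map ?d N (M C) \<rho>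
      = tensor_map ?d ?d id_map ?d N (\<lambda>B. C (gather {..<N} N (\<lambda>i r. i * N + r) B)) \<rho>"
      by (rule tensor_map_cong) (rule M_gather[OF C])
    also have "\<dots> = tensor_map ?d ?d id_map N N C (tensor_map ?d ?d id_map ?d N (gather {..<N} N (\<lambda>i r. i * N + r)) \<rho>)"
      by (rule tensor_id_comp[OF linear_superop_gather C]) (auto intro: pair_index_less)
    also have "tensor_map ?d ?d id_map ?d N (gather {..<N} N (\<lambda>i r. i * N + r)) \<rho> = gather {..<N} ?k h \<rho>"
      unfolding h_def by (rule tensor_id_gather) (auto intro: pair_index_less)
    finally show ?thesis .
  qed
  have h_digits: "h i (e * N + b) = (e * N + i) * N + b" if "b < N" for i e b
    using that unfolding h_def by (simp add: algebra_simps)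
  have h_less: "h i r < ?m" if "i < N" "r < ?k" for i r
    unfolding h_def
    by (rule pair_index_less[OF div_mod_less(1)[OF that(2)] pair_index_less[OF that(1) div_mod_less(2)[OF that(2)]]])
  have hd: "gather {..<N} ?k h \<rho> \<in> density_operators ?k" if "\<rho> \<in> density_operators ?m" for \<rho>
  proof (rule gather_density[OF that], rule bij_betw_byWitness)
    let ?w = "\<lambda>t. (t div N mod N, (t div ?d) * N + t mod N)"
    show "\<forall>p\<in>{..<N} \<times> {..<?k}. ?w (case p of (i, r) \<Rightarrow> h i r) = p"
    proof
      fix p assume "p \<in> {..<N} \<times> {..<?k}"
      then obtain i r where p: "p = (i, r)" "i < N" "r < ?k" by auto
      from p(3) obtain e b where r: "e < ?d" "b < N" "r = e * N + b" by (rule obtain_pair)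
      show "?w (case p of (i, r) \<Rightarrow> h i r) = p"
        using p r by (simp add: div_mult_swap h_digits)
    qed
    show "\<forall>t\<in>{..<?m}. (case ?w t of (i, r) \<Rightarrow> h i r) = t"
    proof
      fix t assume "t \<in> {..<?m}"
      then obtain e a b where t: "e < ?d" "a < N" "b < N" "t = (e * N + a) * N + b"
        by (auto elim: obtain_triple)
      show "(case ?w t of (i, r) \<Rightarrow> h i r) = t"
        unfolding t(4) using t by (simp add: div_mult_swap h_digits)
    qed
    show "(\<lambda>(i, r). h i r) ` ({..<N} \<times> {..<?k}) \<subseteq> {..<?m}"
      using h_less by auto
    show "?w ` {..<?m} \<subseteq> {..<N} \<times> {..<?k}"
    proof
      fix p assume "p \<in> ?w ` {..<?m}"
      then obtain t where t: "t < ?m" "p = ?w t" by auto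
      have "t div ?d * N + t mod N < ?k"
        using div_mod_less(1)[OF t(1)] N0 by (intro pair_index_less) auto
      then show "p \<in> {..<N} \<times> {..<?k}" unfolding t(2) using N0 by simp
    qed
  qed
  have Qd: "tensor_map ?d ?d id_map ?d N (M C) \<rho> \<in> density_operators ?k"
    if "C \<in> channels N N" "\<rho> \<in> density_operators ?m" for C \<rho>
  proof -
    have "linear_superop N N C" using that by (simp add: channels_def)
    then show ?thesis using Q channel_tensor_density[OF that(1) hd[OF that(2)]] by simp
  qed
  have Pd': "tensor_map ?d ?d id_map ?d N L \<rho> \<in> density_operators ?k" if "\<rho> \<in> density_operators ?m" for \<rho>
    unfolding P by (rule Pd[OF that])
  \<comment> \<open>Alice's input is maximally entangled with part of the reference, and Bob's input is a uniform
    superposition; the reference has dimension \<open>N\<^sup>2\<close>, but only \<open>N\<close> of its basis vectors occur.\<close>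
  define \<psi> :: "nat \<Rightarrow> complex" where "\<psi> t = (if t div ?d = t div N mod N then 1 / of_nat N else 0)" for t
  have \<psi>_digits: "\<psi> ((e * N + a) * N + b) = (if e = a then 1 / of_nat N else 0)" if "a < N" "b < N" for e a b
    using that by (simp add: \<psi>_def div_mult_swap)
  define \<rho> where "\<rho> = pure_state ?m \<psi>"
  have \<rho>: "\<rho> \<in> density_operators ?m"
    unfolding \<rho>_def
  proof (rule pure_state_density)
    \<comment> \<open>Each of the \<open>N^2\<close> pairs \<open>(a, b)\<close> has exactly one
      matching reference label, with weight \<open>1/N^2\<close>.\<close>
    have "(\<Sum>t<?m. (cmod (\<psi> t))\<^sup>2) = (\<Sum>q<?d. \<Sum>e<?d. if e = q div N then 1 / (real N)\<^sup>2 else 0)"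
      unfolding sum_pair_index[of _ ?d ?d]
    proof (subst sum.swap, intro sum.cong refl)
      fix q e assume "q \<in> {..<?d}"
      then obtain a b where ab: "a < N" "b < N" and q: "q = a * N + b" by (auto elim: obtain_pair)
      have "e * ?d + q = (e * N + a) * N + b" "q div N = a"
        unfolding q using ab by (simp_all add: algebra_simps)
      then show "(cmod (\<psi> (e * ?d + q)))\<^sup>2 = (if e = q div N then 1 / (real N)\<^sup>2 else 0)"
        by (simp only: \<psi>_digits[OF ab]) (simp add: norm_divide power_divide)
    qed
    also have "\<dots> = (\<Sum>q<?d. 1 / (real N)\<^sup>2)"
    proof (intro sum.cong refl)
      fix q assume "q \<in> {..<?d}"
      then have "q div N < N" using div_mod_less(1)[of q N N] by simp
      also have "N \<le> ?d" by simp
      finally show "(\<Sum>e<?d. if e = q div N then 1 / (real N)\<^sup>2 else 0) = 1 / (real N)\<^sup>2" by simp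
    qed
    also have "\<dots> = 1" using N0 by (simp add: power2_eq_square)
    finally show "(\<Sum>t<?m. (cmod (\<psi> t))\<^sup>2) = 1" .
  qed
  \<comment> \<open>Up to the factor \<open>1 / sqrt N\<close>, these are the vectors
    \<open>\<psi> \<circ> f c\<close> that remain when \<open>A'\<close> is found in state
    \<open>c\<close>.\<close>
  define \<phi> where "\<phi> c = graph_vec N (\<lambda>b. xor b c) (\<lambda>_. 1)" for c
  have xd: "xor b c < ?d" if "b < N" "c < N" for b c
    using x[OF that] by (rule order.strict_trans2) simp
  have bessel: "bessel_family ?k {..<N} \<phi>"
    unfolding \<phi>_def
  proof (rule bessel_graph_vec)
    show "inj_on (\<lambda>c. xor b c) {..<N}" for b
      by (rule inj_on_inverseI[of _ "\<lambda>a. xor b a"]) (simp flip: xor.assoc)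
  qed (use N0 xd in auto)
  \<comment> \<open>The term \<open>i = c\<close> of the partial trace alone contributes
    \<open>1/N\<close>; the other terms are nonnegative.\<close>
  have P1: "1 / real N \<le> Re (quad_form ?k (tensor_map ?d ?d id_map ?d N L \<rho>) (\<phi> c))" if c: "c < N" for c
  proof -
    have "(\<Sum>r<?k. cnj (\<phi> c r) * \<psi> (f c r)) = (\<Sum>b<N. cnj 1 * \<psi> (f c (xor b c * N + b))) / of_real (sqrt (real N))"
      unfolding \<phi>_def by (rule inner_graph_vec) (rule xd[OF _ c])
    also have "(\<Sum>b<N. cnj 1 * \<psi> (f c (xor b c * N + b))) = (\<Sum>b<N. 1 / of_nat N)"
    proof (intro sum.cong refl)
      fix b assume "b \<in> {..<N}"
      then have b: "b < N" by simp
      have "f c (xor b c * N + b) = (xor b c * N + xor c b) * N + b"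
        unfolding f_digits[OF b] by (simp add: algebra_simps)
      then show "cnj 1 * \<psi> (f c (xor b c * N + b)) = 1 / of_nat N"
        using \<psi>_digits[OF x[OF c b] b, of "xor b c"] by (simp add: xor.commute)
    qed
    also have "\<dots> = 1" using N0 by simp
    finally have "(cmod (\<Sum>r<?k. cnj (\<phi> c r) * \<psi> (f c r)))\<^sup>2 = 1 / real N"
      by (simp add: norm_divide power_divide)
    moreover have "(cmod (\<Sum>r<?k. cnj (\<phi> c r) * \<psi> (f c r)))\<^sup>2 \<le> (\<Sum>i<N. (cmod (\<Sum>r<?k. cnj (\<phi> c r) * \<psi> (f i r)))\<^sup>2)"
      using c by (intro member_le_sum[where f = "\<lambda>i. (cmod (\<Sum>r<?k. cnj (\<phi> c r) * \<psi> (f i r)))\<^sup>2"]) auto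
    moreover have "quad_form ?k (tensor_map ?d ?d id_map ?d N L \<rho>) (\<phi> c)
      = of_real (\<Sum>i<N. (cmod (\<Sum>r<?k. cnj (\<phi> c r) * \<psi> (f i r)))\<^sup>2)"
      unfolding P \<rho>_def by (rule quad_form_gather_pure) (use f_less in auto)
    ultimately show ?thesis by (simp del: of_real_sum of_real_power)
  qed
  have Q1: "quad_form ?k (tensor_map ?d ?d id_map ?d N (M C) \<rho>) (\<phi> c) = 1 / of_nat (N * N)"
    if C: "C \<in> channels N N" and c: "c < N" for C c
  proof -
    have lin: "linear_superop N N C" and tr: "\<And>B. B \<in> carrier_mat N N \<Longrightarrow> mat_trace (C B) = mat_trace B"
      using C by (auto simp: channels_def)
    \<comment> \<open>\<open>1/N\<close> times the projection onto the uniform superposition on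
      \<open>B\<close>, hence of trace \<open>1/N\<close>.\<close>
    define K :: "complex mat" where "K = mat N N (\<lambda>_. 1 / of_nat (N * N))"
    have K: "K \<in> carrier_mat N N" by (simp add: K_def)
    have CK: "C K \<in> carrier_mat N N" by (rule linear_superop_carrier[OF lin K])
    \<comment> \<open>Discarding \<open>A\<close> destroys the entanglement: the reduced state is
      diagonal in the reference label, with the same \<open>K\<close> at each of the first
      \<open>N\<close> values.\<close>
    have blk: "block N (gather {..<N} ?k h \<rho>) a a' = (if a = a' then 1 else 0) \<cdot>\<^sub>m K" if a: "a < N" "a' < N" for a a'
    proof (rule eq_matI)
      fix k l assume "k < dim_row ((if a = a' then 1 else 0) \<cdot>\<^sub>m K)" "l < dim_col ((if a = a' then 1 else 0) \<cdot>\<^sub>m K)"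
      then have kl: "k < N" "l < N" by (auto simp: K_def)
      have ad: "a < ?d" "a' < ?d" using a by (auto intro: order.strict_trans2)
      have less: "(e * N + i) * N + b < ?m" if "e < ?d" "i < N" "b < N" for e i b
        using that pair_index_less[of "e * N + i" "?d * N" b N] pair_index_less[of e ?d i N] by (simp add: mult.assoc)
      have "block N (gather {..<N} ?k h \<rho>) a a' $$ (k, l) = (\<Sum>i<N. \<rho> $$ (h i (a * N + k), h i (a' * N + l)))"
        using kl ad by (simp add: block_def gather_def pair_index_less)
      also have "\<dots> = (\<Sum>i<N. if i = a then (if a = a' then 1 / of_nat (N * N) else 0) else 0)"
        using kl ad less by (intro sum.cong refl) (auto simp: h_digits \<rho>_def pure_state_def \<psi>_digits)
      also have "\<dots> = (if a = a' then 1 / of_nat (N * N) else 0)" using a by simp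
      finally show "block N (gather {..<N} ?k h \<rho>) a a' $$ (k, l) = ((if a = a' then 1 else 0) \<cdot>\<^sub>m K) $$ (k, l)"
        using kl by (simp add: K_def)
    qed (auto simp: K_def block_def)
    have CcK: "C (z \<cdot>\<^sub>m K) = z \<cdot>\<^sub>m C K" for z using lin K by (simp add: linear_superop_def)
    have entry: "tensor_map ?d ?d id_map ?d N (M C) \<rho> $$ (xor b c * N + b, xor b' c * N + b') = (if b' = b then C K $$ (b, b) else 0)"
      if b: "b < N" "b' < N" for b b'
    proof -
      \<comment> \<open>Different \<open>b\<close> come with different reference labels, so the
        coherences that the test vector probes are absent from the comparison state.\<close>
      have inj: "xor b c = xor b' c \<longleftrightarrow> b' = b" by (metis xor_xor_cancel)
      have "tensor_map ?d ?d id_map ?d N (M C) \<rho> $$ (xor b c * N + b, xor b' c * N + b')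
        = C (block N (gather {..<N} ?k h \<rho>) (xor b c) (xor b' c)) $$ (b, b')"
        unfolding Q[OF lin] using b xd c by (subst tensor_id_index[OF lin]) (auto simp: pair_index_less)
      then show ?thesis
        using b CK inj by (auto simp: blk x c CcK)
    qed
    have "quad_form ?k (tensor_map ?d ?d id_map ?d N (M C) \<rho>) (\<phi> c)
      = (\<Sum>b<N. \<Sum>b'<N. cnj 1 * tensor_map ?d ?d id_map ?d N (M C) \<rho> $$ (xor b c * N + b, xor b' c * N + b') * 1) / of_nat N"
      unfolding \<phi>_def by (rule quad_form_graph_vec) (rule xd[OF _ c])
    also have "\<dots> = (\<Sum>b<N. C K $$ (b, b)) / of_nat N"
      by (simp add: entry)
    also have "(\<Sum>b<N. C K $$ (b, b)) = mat_trace (C K)" using CK by (simp add: mat_trace_def)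
    also have "\<dots> = 1 / of_nat N" using N0 by (simp add: tr[OF K]) (simp add: mat_trace_def K_def)
    finally show ?thesis by simp
  qed
  have bounds: "0 \<le> diamond_norm ?d N (\<lambda>\<rho>. L \<rho> - M C \<rho>)" "diamond_norm ?d N (\<lambda>\<rho>. L \<rho> - M C \<rho>) \<le> 2"
    "2 - 2 / real N \<le> diamond_norm ?d N (\<lambda>\<rho>. L \<rho> - M C \<rho>)" if C: "C \<in> channels N N" for C
  proof -
    note b = diamond_norm_diff_bounds[OF linL linM Pd' Qd[OF C] \<rho>]
    show "0 \<le> diamond_norm ?d N (\<lambda>\<rho>. L \<rho> - M C \<rho>)" "diamond_norm ?d N (\<lambda>\<rho>. L \<rho> - M C \<rho>) \<le> 2"
      by (rule b(1), assumption, assumption) (rule b(2), assumption, assumption)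
    have "2 - 2 / real N = 2 * (\<Sum>c<N. 1 / real N - 1 / real (N * N))"
      using N0 by (simp add: field_simps)
    also have "\<dots> \<le> 2 * (\<Sum>c<N. Re (quad_form ?k (tensor_map ?d ?d id_map ?d N L \<rho>) (\<phi> c))
        - Re (quad_form ?k (tensor_map ?d ?d id_map ?d N (M C) \<rho>) (\<phi> c)))"
    proof (intro mult_left_mono sum_mono)
      fix c assume "c \<in> {..<N}"
      then have c: "c < N" by simp
      have "Re (1 / of_nat (N * N)) = 1 / real (N * N)" by (metis Re_complex_of_real of_real_1 of_real_divide of_real_of_nat_eq)
      then show "1 / real N - 1 / real (N * N) \<le> Re (quad_form ?k (tensor_map ?d ?d id_map ?d N L \<rho>) (\<phi> c))
        - Re (quad_form ?k (tensor_map ?d ?d id_map ?d N (M C) \<rho>) (\<phi> c))"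
        using P1[OF c] unfolding Q1[OF C c] by linarith
    qed simp
    also have "\<dots> \<le> diamond_norm ?d N (\<lambda>\<rho>. L \<rho> - M C \<rho>)"
      by (rule b(3)[OF _ _ bessel])
    finally show "2 - 2 / real N \<le> diamond_norm ?d N (\<lambda>\<rho>. L \<rho> - M C \<rho>)" .
  qed
  have sig: "signalling N N N N U = (INF C\<in>channels N N. diamond_norm ?d N (\<lambda>\<rho>. L \<rho> - M C \<rho>))"
    by (simp add: signalling_def L_def M_def)
  show "2 - 2 / real N \<le> signalling N N N N U"
    unfolding sig using id_channel[of N] bounds(3) by (intro cINF_greatest) auto
  \<comment> \<open>Any channel bounds the infimum from above; the identity serves as the
    witness.\<close>
  have "(INF C\<in>channels N N. diamond_norm ?d N (\<lambda>\<rho>. L \<rho> - M C \<rho>)) \<le> diamond_norm ?d N (\<lambda>\<rho>. L \<rho> - M id_map \<rho>)"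
    using bounds(1) by (intro cINF_lower[OF _ id_channel] bdd_belowI2[of _ 0]) auto
  then show "signalling N N N N U \<le> 2" unfolding sig using bounds(2)[OF id_channel] by linarith
qed

text \<open>Ensures that the comparison map of the causal influence sends states to states. For
  complete positivity the idle factor \<open>e\<close> is moved into the reference: up to
  permutations of factors, \<open>id_k \<otimes> C \<otimes> id_e\<close> is \<open>C\<close> with a
  reference of dimension \<open>k * e\<close>.\<close>

lemma tensor_channel_id:
  assumes C: "C \<in> channels dX dY"
  shows "tensor_map dX dY C e e id_map \<in> channels (dX * e) (dY * e)"
proof -
  have lin: "linear_superop dX dY C"
    and cp: "\<And>k \<rho>. \<rho> \<in> carrier_mat (k * dX) (k * dX) \<Longrightarrow> psd \<rho> \<Longrightarrow> psd (tensor_map k k id_map dX dY C \<rho>)"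
    and tr: "\<And>B. B \<in> carrier_mat dX dX \<Longrightarrow> mat_trace (C B) = mat_trace B"
    using C by (auto simp: channels_def)
  let ?T = "tensor_map dX dY C e e id_map"
  have T_index: "?T B $$ (z * e + b, z' * e + b') = C (mat dX dX (\<lambda>(i, j). B $$ (i * e + b, j * e + b'))) $$ (z, z')"
    if "z < dY" "z' < dY" "b < e" "b' < e" for B z z' b b'
    using that by (subst tensor_map_index[OF lin linear_superop_id]) (auto simp: id_map_def block_def pair_index_less)
  have "psd (tensor_map k k id_map (dX * e) (dY * e) ?T \<rho>)"
    if \<rho>: "\<rho> \<in> carrier_mat (k * (dX * e)) (k * (dX * e))" "psd \<rho>" for k \<rho>
  proof -
    \<comment> \<open>\<open>w\<close> and \<open>u\<close> are the factor permutations before and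
      after \<open>C\<close>: the digit of the idle factor passes the system digit to join the
      reference, and then returns.\<close>
    define w where "w r = (r div dX div e) * (dX * e) + ((r mod dX) * e + r div dX mod e)" for r
    define u where "u r = ((r div e div dY) * e + r mod e) * dY + r div e mod dY" for r
    let ?\<rho> = "gather {()} ((k * e) * dX) (\<lambda>_. w) \<rho>"
    let ?\<sigma> = "tensor_map (k * e) (k * e) id_map dX dY C ?\<rho>"
    have "w r < k * (dX * e)" if "r < k * e * dX" for r
    proof -
      note 1 = div_mod_less[OF that]
      note 2 = div_mod_less[OF 1(1)]
      show ?thesis unfolding w_def by (rule pair_index_less[OF 2(1) pair_index_less[OF 1(2) 2(2)]])
    qed
    then have psd1: "psd ?\<rho>" by (intro psd_gather[OF \<rho>]) auto
    have psd2: "psd ?\<sigma>" by (rule cp[OF _ psd1]) simp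
    have u_less: "u r < k * e * dY" if r: "r < k * dY * e" for r
    proof -
      note 1 = div_mod_less[OF r]
      note 2 = div_mod_less[OF 1(1)]
      show ?thesis unfolding u_def by (rule pair_index_less[OF pair_index_less[OF 2(1) 1(2)] 2(2)])
    qed
    have "tensor_map k k id_map (dX * e) (dY * e) ?T \<rho> = gather {()} (k * (dY * e)) (\<lambda>_. u) ?\<sigma>" (is "?l = ?r")
    proof (rule eq_matI)
      fix r s assume "r < dim_row ?r" "s < dim_col ?r"
      then have rs: "r < k * (dY * e)" "s < k * (dY * e)" by (auto simp: gather_def)
      from rs(1) obtain a z b where r: "a < k" "z < dY" "b < e" "r = (a * dY + z) * e + b" by (rule obtain_triple)
      from rs(2) obtain a' z' b' where s: "a' < k" "z' < dY" "b' < e" "s = (a' * dY + z') * e + b'" by (rule obtain_triple)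
      have r': "r = a * (dY * e) + (z * e + b)" and s': "s = a' * (dY * e) + (z' * e + b')"
        unfolding r(4) s(4) by (simp_all add: algebra_simps)
      have zb: "z * e + b < dY * e" "z' * e + b' < dY * e" using r s pair_index_less by auto
      have "?l $$ (r, s) = ?T (block (dX * e) \<rho> a a') $$ (z * e + b, z' * e + b')"
        unfolding tensor_id_index[OF linear_superop_tensor rs] unfolding r' s'
        by (simp only: pair_index_div[OF zb(1)] pair_index_div[OF zb(2)] pair_index_mod[OF zb(1)] pair_index_mod[OF zb(2)])
      also have "\<dots> = C (mat dX dX (\<lambda>(i, j). block (dX * e) \<rho> a a' $$ (i * e + b, j * e + b'))) $$ (z, z')"
        by (rule T_index[OF r(2) s(2) r(3) s(3)])
      also have "mat dX dX (\<lambda>(i, j). block (dX * e) \<rho> a a' $$ (i * e + b, j * e + b')) = block dX ?\<rho> (a * e + b) (a' * e + b')"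
      proof (rule eq_matI)
        fix i j assume "i < dim_row (block dX ?\<rho> (a * e + b) (a' * e + b'))" "j < dim_col (block dX ?\<rho> (a * e + b) (a' * e + b'))"
        then have ij: "i < dX" "j < dX" by (auto simp: block_def)
        have l: "(a * e + b) * dX + i < k * e * dX" "(a' * e + b') * dX + j < k * e * dX"
          using r s ij by (auto intro!: pair_index_less)
        have "w ((a * e + b) * dX + i) = a * (dX * e) + (i * e + b)" "w ((a' * e + b') * dX + j) = a' * (dX * e) + (j * e + b')"
          unfolding w_def using r s ij by simp_all
        then show "mat dX dX (\<lambda>(i, j). block (dX * e) \<rho> a a' $$ (i * e + b, j * e + b')) $$ (i, j)
          = block dX ?\<rho> (a * e + b) (a' * e + b') $$ (i, j)"
          using l ij r s by (simp add: block_def gather_def pair_index_less)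
      qed (auto simp: block_def)
      also have "C (block dX ?\<rho> (a * e + b) (a' * e + b')) $$ (z, z') = ?\<sigma> $$ (u r, u s)"
      proof -
        have "u r = (a * e + b) * dY + z" "u s = (a' * e + b') * dY + z'"
          unfolding r(4) s(4) u_def using r s by simp_all
        moreover have "(a * e + b) * dY + z < k * e * dY" "(a' * e + b') * dY + z' < k * e * dY"
          using r s by (auto intro!: pair_index_less)
        ultimately show ?thesis
          using r(2) s(2) by (simp add: tensor_id_index[OF lin])
      qed
      finally show "?l $$ (r, s) = ?r $$ (r, s)" using rs by (simp add: gather_def)
    qed (auto simp: gather_def tensor_map_def)
    moreover have "psd (gather {()} (k * (dY * e)) (\<lambda>_. u) ?\<sigma>)"
      by (rule psd_gather[OF tensor_map_carrier psd2]) (use u_less in \<open>simp add: mult.assoc\<close>)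
    ultimately show ?thesis by simp
  qed
  moreover have "mat_trace (?T B) = mat_trace B" if B: "B \<in> carrier_mat (dX * e) (dX * e)" for B
  proof -
    have "mat_trace (?T B) = (\<Sum>z<dY. \<Sum>b<e. ?T B $$ (z * e + b, z * e + b))"
      by (simp add: mat_trace_def sum_pair_index carrier_matD(1)[OF tensor_map_carrier])
    also have "\<dots> = (\<Sum>b<e. \<Sum>z<dY. ?T B $$ (z * e + b, z * e + b))" by (rule sum.swap)
    also have "\<dots> = (\<Sum>b<e. mat_trace (C (mat dX dX (\<lambda>(i, j). B $$ (i * e + b, j * e + b)))))"
    proof (intro sum.cong refl)
      fix b assume "b \<in> {..<e}"
      moreover have "C (mat dX dX (\<lambda>(i, j). B $$ (i * e + b, j * e + b))) \<in> carrier_mat dY dY"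
        by (rule linear_superop_carrier[OF lin]) simp
      ultimately show "(\<Sum>z<dY. ?T B $$ (z * e + b, z * e + b)) = mat_trace (C (mat dX dX (\<lambda>(i, j). B $$ (i * e + b, j * e + b))))"
        by (simp add: mat_trace_def T_index)
    qed
    also have "\<dots> = (\<Sum>b<e. \<Sum>i<dX. B $$ (i * e + b, i * e + b))"
      by (simp add: tr) (simp add: mat_trace_def)
    also have "\<dots> = (\<Sum>i<dX. \<Sum>b<e. B $$ (i * e + b, i * e + b))" by (rule sum.swap)
    also have "\<dots> = mat_trace B" using B by (simp add: mat_trace_def sum_pair_index)
    finally show ?thesis .
  qed
  ultimately show ?thesis by (simp add: channels_def)
qed

section \<open>The parity character and the causal influence\<close>

lemma sum_alternating_power:
  assumes "0 < n" shows "(\<Sum>b<2 ^ n. (-1) ^ b) = (0 :: complex)"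
proof -
  have "(\<Sum>b<k * 2. (-1) ^ b) = (0 :: complex)" for k :: nat by (induction k) auto
  moreover obtain m where "n = Suc m" using assms by (cases n) auto
  ultimately show ?thesis by (metis power_Suc2)
qed

text \<open>This makes \<open>(-1) ^ b\<close> a character for bitwise xor. It reads only the lowest
  bit, so it is nontrivial as soon as there is one qubit.\<close>

lemma minus_one_power_xor: "(-1) ^ xor a b = ((-1) ^ a * (-1) ^ b :: 'a :: ring_1)" for a b :: nat
  by (simp add: minus_one_power_iff even_xor_iff)

text \<open>The test asks whether the reference is in state 0 and \<open>B'\<close> carries the
  parity character; the vectors \<open>\<phi> z\<close> run through a basis of \<open>A\<close> and
  \<open>A'\<close>, where nothing is tested. The true output passes with certainty and every
  competitor with probability 0.\<close>

lemma causal_influence_eq_2: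
  assumes n: "0 < n" and N: "N = 2 ^ n" and U: "relabels (N * N) (N * N) (cnot_index N) U"
  shows "causal_influence N N N N U = 2"
proof -
  have N0: "0 < N" unfolding N by simp
  have x: "xor a b < N" if "a < N" "b < N" for a b using xor_less_power that N by simp
  let ?d = "N * N" and ?k = "N * N * N"
  let ?m = "?k * ?k"
  define L where "L = T_map N N N N U"
  define M where "M C = tensor_map ?d ?d C N N id_map" for C
  have L: "relabels ?k ?k (T_index N) L" unfolding L_def by (rule relabels_T_map[OF N U])
  have linL: "linear_superop ?k ?k L" by (rule relabels_linear[OF L])
  have linM: "linear_superop ?k ?k (M C)" for C unfolding M_def by (rule linear_superop_tensor)
  define f where "f r = (r div ?k) * ?k + T_index N (r mod ?k)" for r
  have P: "tensor_map ?k ?k id_map ?k ?k L \<rho> = gather {()} ?m (\<lambda>_. f) \<rho>" for \<rho>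
    unfolding f_def
    by (rule tensor_id_gather[of "{()}" ?k "\<lambda>_. T_index N" ?k])
       (use relabels_less[OF L] relabels_gather[OF L] in auto)
  have f_less: "f r < ?m" if "r < ?m" for r
    unfolding f_def by (rule pair_index_less[OF div_mod_less(1)[OF that] relabels_less[OF L div_mod_less(2)[OF that]]])
  \<comment> \<open>Involutivity makes \<open>f\<close> a permutation of labels, which is how states
    are seen to go to states.\<close>
  have T_inv: "T_index N (T_index N r) = r" if "r < ?k" for r
  proof -
    from that have "r < N * (N * N)" by (simp add: mult.assoc)
    then obtain a y b where "a < N" "y < N" "b < N" "r = (a * N + y) * N + b" by (rule obtain_triple)
    then show ?thesis by (simp add: T_index_digits x)
  qed
  have f_inv: "f (f r) = r" if "r < ?m" for r
  proof -
    have l: "T_index N (r mod ?k) < ?k" by (rule relabels_less[OF L div_mod_less(2)[OF that]])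
    have "f (f r) = (r div ?k) * ?k + T_index N (T_index N (r mod ?k))"
      unfolding f_def by (simp only: pair_index_div[OF l] pair_index_mod[OF l])
    also have "\<dots> = r" unfolding T_inv[OF div_mod_less(2)[OF that]] by (rule div_mult_mod_eq)
    finally show ?thesis .
  qed
  have Pd: "tensor_map ?k ?k id_map ?k ?k L \<rho> \<in> density_operators ?m" if "\<rho> \<in> density_operators ?m" for \<rho>
    unfolding P
  proof (rule gather_density[OF that], rule bij_betw_byWitness)
    show "\<forall>p\<in>{()} \<times> {..<?m}. ((), f (case p of (i, r) \<Rightarrow> f r)) = p" using f_inv by auto
    show "\<forall>t\<in>{..<?m}. (case ((), f t) of (i, r) \<Rightarrow> f r) = t" using f_inv by auto
    show "(\<lambda>(i, r). f r) ` ({()} \<times> {..<?m}) \<subseteq> {..<?m}" using f_less by auto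
    show "(\<lambda>t. ((), f t)) ` {..<?m} \<subseteq> {()} \<times> {..<?m}" using f_less by auto
  qed
  have Qd: "tensor_map ?k ?k id_map ?k ?k (M C) \<rho> \<in> density_operators ?m"
    if "C \<in> channels ?d ?d" "\<rho> \<in> density_operators ?m" for C \<rho>
    unfolding M_def by (rule channel_tensor_density[OF tensor_channel_id[OF that(1)] that(2)])
  have k_le: "?k \<le> ?m" by simp
  have k0: "0 < ?k" using N0 by simp
  \<comment> \<open>Amplitude of a uniform superposition over the \<open>N^3\<close> labels of
    \<open>A\<close>, \<open>A'\<close> and \<open>B'\<close>.\<close>
  define c :: complex where "c = 1 / of_real (sqrt (real ?k))"
  have cc: "c * cnj c = 1 / of_nat ?k"
  proof -
    have "c * cnj c = 1 / of_real (sqrt (real ?k) * sqrt (real ?k))" by (simp only: c_def of_real_mult) simp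
    then show ?thesis by (simp only: real_sqrt_mult_self) simp
  qed
  have cmodc: "(cmod c)\<^sup>2 = 1 / real ?k"
    unfolding c_def by (simp add: norm_divide power_divide)
  \<comment> \<open>The reference is in state \<open>|0\<rangle>\<close>, \<open>A\<close> carries the parity character, \<open>A'\<close> and \<open>B'\<close> are uniform.\<close>
  define \<psi> :: "nat \<Rightarrow> complex" where "\<psi> t = (if t < ?k then (-1) ^ (t div ?d) * c else 0)" for t
  define \<rho> where "\<rho> = pure_state ?m \<psi>"
  have \<rho>: "\<rho> \<in> density_operators ?m"
    unfolding \<rho>_def
  proof (rule pure_state_density)
    have "(\<Sum>t<?m. (cmod (\<psi> t))\<^sup>2) = (\<Sum>t<?k. (cmod (\<psi> t))\<^sup>2)"
      using k_le by (intro sum.mono_neutral_right) (auto simp: \<psi>_def)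
    also have "\<dots> = (\<Sum>t<?k. 1 / real ?k)"
      by (intro sum.cong refl) (simp only: \<psi>_def lessThan_iff if_True norm_mult norm_power norm_minus_cancel norm_one power_one mult_1 cmodc)
    also have "\<dots> = 1" using k0 by (simp only: sum_constant card_lessThan) simp
    finally show "(\<Sum>t<?m. (cmod (\<psi> t))\<^sup>2) = 1" .
  qed
  define \<phi> where "\<phi> z = graph_vec N (\<lambda>_. z) (\<lambda>b. (-1) ^ b)" for z
  \<comment> \<open>Reference, \<open>A\<close> and \<open>A'\<close> together form the first digit,
    so \<open>z < ?d\<close> puts the reference in state 0.\<close>
  let ?D = "?k * ?d"
  have mD: "?m = ?D * N" by (simp add: mult.assoc)
  have zD: "z < ?D" if "z < ?d" for z
    using that k0 by (metis One_nat_def Suc_leI less_le_trans mult.commute mult_le_mono2 nat_mult_1_right)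
  have bessel: "bessel_family ?m {..<?d} \<phi>"
    unfolding mD \<phi>_def
  proof (rule bessel_graph_vec)
    show "inj_on (\<lambda>z. z) {..<?d}" by simp
  qed (use N0 zD in \<open>auto simp: norm_power\<close>)
  have zb: "z * N + b < ?k" if "z < ?d" "b < N" for z b using that by (rule pair_index_less)
  have P1: "Re (quad_form ?m (tensor_map ?k ?k id_map ?k ?k L \<rho>) (\<phi> z)) = 1 / real ?d" if z: "z < ?d" for z
  proof -
    from z obtain a y where ay: "a < N" "y < N" "z = a * N + y" by (rule obtain_pair)
    have "(\<Sum>r<?m. cnj (\<phi> z r) * \<psi> (f r)) = (\<Sum>b<N. cnj ((-1) ^ b) * \<psi> (f (z * N + b))) / of_real (sqrt (real N))"
      unfolding mD \<phi>_def by (rule inner_graph_vec) (rule zD[OF z])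
    \<comment> \<open>Kickback: the label read in \<open>A\<close> is \<open>xor y b\<close>, so the
      amplitude carries a factor \<open>(-1) ^ b\<close>, which the test vector cancels. All
      \<open>N\<close> terms agree and add up coherently.\<close>
    also have "(\<Sum>b<N. cnj ((-1) ^ b) * \<psi> (f (z * N + b))) = (\<Sum>b<N. (-1) ^ y * c)"
    proof (intro sum.cong refl)
      fix b assume "b \<in> {..<N}"
      then have b: "b < N" by simp
      have "f (z * N + b) = T_index N (z * N + b)" using zb[OF z b] by (simp add: f_def)
      also have "\<dots> = (xor y b * N + xor a b) * N + b" unfolding ay(3) by (rule T_index_digits[OF ay(2) b])
      finally have f: "f (z * N + b) = (xor y b * N + xor a b) * N + b" .
      have "(xor y b * N + xor a b) * N + b < ?k"
        by (rule zb[OF pair_index_less[OF x[OF ay(2) b] x[OF ay(1) b]] b])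
      moreover have "((xor y b * N + xor a b) * N + b) div ?d = xor y b"
        using x ay b by (simp add: div_mult_swap)
      ultimately have "\<psi> (f (z * N + b)) = (-1) ^ xor y b * c"
        unfolding f \<psi>_def by simp
      then show "cnj ((-1) ^ b) * \<psi> (f (z * N + b)) = (-1) ^ y * c"
        by (simp add: minus_one_power_xor mult.assoc)
    qed
    finally have "(cmod (\<Sum>r<?m. cnj (\<phi> z r) * \<psi> (f r)))\<^sup>2 = (real N)\<^sup>2 * (cmod c)\<^sup>2 / real N"
      by (simp add: norm_divide norm_mult norm_power power_divide power_mult_distrib)
    also have "\<dots> = 1 / real ?d" unfolding cmodc using N0 by (simp add: power2_eq_square)
    finally have "(cmod (\<Sum>r<?m. cnj (\<phi> z r) * \<psi> (f r)))\<^sup>2 = 1 / real ?d" .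
    moreover have "quad_form ?m (tensor_map ?k ?k id_map ?k ?k L \<rho>) (\<phi> z)
      = of_real (\<Sum>i\<in>{()}. (cmod (\<Sum>r<?m. cnj (\<phi> z r) * \<psi> (f r)))\<^sup>2)"
      unfolding P \<rho>_def by (rule quad_form_gather_pure) (rule f_less)
    ultimately show ?thesis by (simp del: of_real_sum of_real_power of_nat_mult)
  qed
  have Q1: "quad_form ?m (tensor_map ?k ?k id_map ?k ?k (M C) \<rho>) (\<phi> z) = 0"
    if C: "C \<in> channels ?d ?d" and z: "z < ?d" for C z
  proof -
    have lin: "linear_superop ?d ?d C" using C by (auto simp: channels_def)
    \<comment> \<open>The block of the input on \<open>A\<close> and \<open>A'\<close> between two
      labels of \<open>B'\<close>; it is the same for every pair of labels because \<open>B'\<close>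
      starts uniform.\<close>
    define K :: "complex mat" where "K = mat ?d ?d (\<lambda>(i, j). (-1) ^ (i div N) * (-1) ^ (j div N) * (c * cnj c))"
    have entry: "tensor_map ?k ?k id_map ?k ?k (M C) \<rho> $$ (z * N + b, z * N + b') = C K $$ (z, z)"
      if b: "b < N" "b' < N" for b b'
    proof -
      have zm: "z * N + b < ?m" "z * N + b' < ?m" using zb[OF z b(1)] zb[OF z b(2)] k_le by linarith+
      have "tensor_map ?k ?k id_map ?k ?k (M C) \<rho> $$ (z * N + b, z * N + b') = M C (block ?k \<rho> 0 0) $$ (z * N + b, z * N + b')"
        unfolding tensor_id_index[OF linM zm] using zb[OF z b(1)] zb[OF z b(2)] by simp
      also have "\<dots> = C (mat ?d ?d (\<lambda>(i, j). block ?k \<rho> 0 0 $$ (i * N + b, j * N + b'))) $$ (z, z)"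
        unfolding M_def tensor_map_index[OF lin linear_superop_id zb[OF z b(1)] zb[OF z b(2)]]
        using b by (simp add: id_map_def block_def[of N])
      also have "mat ?d ?d (\<lambda>(i, j). block ?k \<rho> 0 0 $$ (i * N + b, j * N + b')) = K"
      proof (rule eq_matI)
        fix i j assume "i < dim_row K" "j < dim_col K"
        then have ij: "i < ?d" "j < ?d" by (auto simp: K_def)
        note l = zb[OF ij(1) b(1)] zb[OF ij(2) b(2)]
        have l': "i * N + b < ?m" "j * N + b' < ?m" using l k_le by linarith+
        have "(i * N + b) div ?d = i div N" "(j * N + b') div ?d = j div N" using b by (simp_all add: div_mult_swap)
        then show "mat ?d ?d (\<lambda>(i, j). block ?k \<rho> 0 0 $$ (i * N + b, j * N + b')) $$ (i, j) = K $$ (i, j)"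
          using ij l l' by (simp add: K_def block_def \<rho>_def pure_state_def \<psi>_def)
      qed (auto simp: K_def)
      finally show ?thesis .
    qed
    have "quad_form ?m (tensor_map ?k ?k id_map ?k ?k (M C) \<rho>) (\<phi> z)
      = (\<Sum>b<N. \<Sum>b'<N. cnj ((-1) ^ b) * tensor_map ?k ?k id_map ?k ?k (M C) \<rho> $$ (z * N + b, z * N + b') * (-1) ^ b') / of_nat N"
      unfolding mD \<phi>_def by (rule quad_form_graph_vec) (rule zD[OF z])
    also have "\<dots> = (\<Sum>b<N. \<Sum>b'<N. cnj ((-1) ^ b) * C K $$ (z, z) * (-1) ^ b') / of_nat N"
      by (simp add: entry)
    \<comment> \<open>The matrix entry does not depend on \<open>b\<close> and \<open>b'\<close>, so
      the alternating sum over \<open>b'\<close> factors out and vanishes.\<close>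
    also have "\<dots> = 0"
      using sum_alternating_power[OF n] by (simp add: sum_distrib_left[symmetric] N)
    finally show ?thesis .
  qed
  have bounds: "diamond_norm ?k ?k (\<lambda>\<rho>. L \<rho> - M C \<rho>) = 2" if C: "C \<in> channels ?d ?d" for C
  proof (rule antisym)
    note b = diamond_norm_diff_bounds[OF linL linM Pd Qd[OF C] \<rho>]
    show "diamond_norm ?k ?k (\<lambda>\<rho>. L \<rho> - M C \<rho>) \<le> 2" by (rule b(2), assumption, assumption)
    have "2 = 2 * (\<Sum>z<?d. Re (quad_form ?m (tensor_map ?k ?k id_map ?k ?k L \<rho>) (\<phi> z))
        - Re (quad_form ?m (tensor_map ?k ?k id_map ?k ?k (M C) \<rho>) (\<phi> z)))"
      using N0 by (simp add: P1 Q1[OF C])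
    also have "\<dots> \<le> diamond_norm ?k ?k (\<lambda>\<rho>. L \<rho> - M C \<rho>)" by (rule b(3)[OF _ _ bessel])
    finally show "2 \<le> diamond_norm ?k ?k (\<lambda>\<rho>. L \<rho> - M C \<rho>)" .
  qed
  have "causal_influence N N N N U = (INF C\<in>channels ?d ?d. diamond_norm ?k ?k (\<lambda>\<rho>. L \<rho> - M C \<rho>))"
    by (simp add: causal_influence_def L_def M_def)
  also have "\<dots> = (INF C\<in>channels ?d ?d. 2)" by (intro INF_cong refl) (rule bounds)
  also have "\<dots> = 2" using id_channel[of ?d] by (intro cINF_const) auto
  finally show ?thesis .
qed

theorem mainTheorem12:
  shows "(signalling_power 2 2 2 2 CNOT_channel
            \<longlonglongrightarrow> signalling_infty 2 2 2 2 CNOT_channel)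
       \<and> signalling_infty 2 2 2 2 CNOT_channel = 2
       \<and> (causal_influence_power 2 2 2 2 CNOT_channel
            \<longlonglongrightarrow> causal_influence_infty 2 2 2 2 CNOT_channel)
       \<and> causal_influence_infty 2 2 2 2 CNOT_channel = 2"
proof -
  have "(\<lambda>n. 2 - 2 / 2 ^ n) \<longlonglongrightarrow> (2 - 2 * 0 :: real)"
    unfolding divide_inverse by (intro tendsto_intros LIMSEQ_inverse_realpow_zero) simp
  then have lim: "(\<lambda>n. 2 - 2 / 2 ^ n) \<longlonglongrightarrow> (2 :: real)" by simp
  have bounds: "2 - 2 / 2 ^ n \<le> signalling_power 2 2 2 2 CNOT_channel n" "signalling_power 2 2 2 2 CNOT_channel n \<le> 2" for n
    using signalling_bounds[OF refl relabels_CNOT_power[of n]] by (simp_all add: signalling_power_def)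
  have s: "signalling_power 2 2 2 2 CNOT_channel \<longlonglongrightarrow> 2"
    by (rule tendsto_sandwich[OF always_eventually always_eventually lim tendsto_const]) (simp_all add: bounds)
  have "causal_influence_power 2 2 2 2 CNOT_channel n = 2" if "0 < n" for n
    using causal_influence_eq_2[OF that refl relabels_CNOT_power[of n]] by (simp add: causal_influence_power_def)
  \<comment> \<open>At \<open>n = 0\<close> all systems are one-dimensional, so the constant value
    is claimed only from \<open>n = 1\<close> on.\<close>
  then have c: "causal_influence_power 2 2 2 2 CNOT_channel \<longlonglongrightarrow> 2"
    by (intro tendsto_eventually eventually_sequentiallyI[of 1]) auto
  \<comment> \<open>Both asymptotic quantities are defined by \<open>lim\<close>, whose value is
    pinned down by \<open>limI\<close> once convergence is known.\<close>
  show ?thesis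
    using s c limI[OF s] limI[OF c] by (simp add: signalling_infty_def causal_influence_infty_def)
qed

end
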